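(* Fix an integer $r\ge 3$ and a real $\rho\in[0,1]$. Let $(G_n)$ be a sequence of graphs such that $G_n$ has $n$ vertices and edge density $\rho(G_n)=\rho+o(1)$ as $n\to\infty$. Then \[ \frac{K_r(G_n)+I_r(G_n)}{\binom nr}\le \gamma^r+(1-\gamma)^r+r\gamma(1-\gamma)^{r-1}+o(1)\qquad (n\to\infty), \] where $\gamma=\sqrt{1-\rho}$ if $\rho\le \tfrac12$, and $\gamma=\sqrt{\rho}$ otherwise.
   Context: Graphs are finite and simple. For a graph $G$ with vertex set $V(G)$ and edge set $E(G)$, its edge density is $\rho(G)=|E(G)|/\binom{|V(G)|}{2}$. $K_r(G)$ denotes the number of $r$-element subsets of $V(G)$ that induce a clique (all pairs adjacent), and $I_r(G)$ denotes the number of $r$-element subsets of $V(G)$ that induce an independent set (no pairs adjacent). $o(1)$ denotes a quantity tending to $0$ as $n\to\infty$ with $r$ and $\rho$ fixed; the conclusion is thus that the limit superior of the left-hand side is at most $\gamma^r+(1-\gamma)^r+r\gamma(1-\gamma)^{r-1}$. *)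

theory Defs
  imports Complex_Main "HOL-Library.Ramsey" "HOL-Library.Extended_Real"
begin

text \<open>
  A graph is given by a vertex set and a set of edges, an edge being a two-element set of
  vertices. This is the representation for which \<^theory>\<open>HOL-Library.Ramsey\<close> defines
  \<^const>\<open>clique\<close>, \<^const>\<open>indep\<close> and \<^const>\<open>nsets\<close>.
\<close>

definition finite_simple_graph :: "'a set \<Rightarrow> 'a set set \<Rightarrow> bool" where
  "finite_simple_graph V E \<longleftrightarrow> finite V \<and> E \<subseteq> nsets V 2"

definition edge_density :: "'a set \<Rightarrow> 'a set set \<Rightarrow> real" where
  "edge_density V E = real (card E) / real (card V choose 2)"

definition num_cliques :: "nat \<Rightarrow> 'a set \<Rightarrow> 'a set set \<Rightarrow> nat" where
  "num_cliques r V E = card {R \<in> nsets V r. clique R E}"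

definition num_indeps :: "nat \<Rightarrow> 'a set \<Rightarrow> 'a set set \<Rightarrow> nat" where
  "num_indeps r V E = card {R \<in> nsets V r. indep R E}"

end

theory Submission
  imports Defs
begin

text \<open>
  Shifting edges towards a fixed end of the vertex set keeps the number of edges and does not decrease
  the number of $r$-cliques or of independent $r$-sets, so the graph may be assumed to be a threshold
  graph: its vertices can be removed one by one, each being dominating or isolated at its removal.
  If $a_i$ and $b_i$ count the dominating and isolated vertices among the first $i$, then the graph has
  $\sum a_i$ edges, at most $\sum \binom{a_i}{r-1}$ cliques and at most $\sum \binom{b_i}{r-1}$
  independent sets. The pairs $(a_i, b_i)$ form a lattice path, and the maximum of
  $\sum (a_i^{r-1} + b_i^{r-1})$ for a given end point and area is attained by a path with two turns.
  Letting the end point vary at fixed edge density, the value of such a path is quasi-convex, hence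
  largest for a quasi-clique or a quasi-star; comparing these two gives $\gamma$.
\<close>

section \<open>Lattice paths\<close>

text \<open>Throughout, \<open>q\<close> stands for r - 2. Which of the two candidate paths is
  better depends on the end point, so the induction along a path carries the maximum of both. A step
  lengthens the last piece of one candidate, which thereby grows by exactly the new summand; the
  growth of the other candidate matters only if it is the larger one, and that very assumption makes
  its growth sufficient. No exchange argument on paths is needed. The discrete sums are bounded by
  powers and areas of the continuous path without error term; the price is a change of the density
  by at most 1/n. What remains concerns homogeneous functions of real lengths, so the total length
  may be taken to be 1. Complementing the graph reflects the path, so only up-right-up paths are
  analysed. The derivative along this family has no evident sign pattern; after division by a
  suitable positive factor it becomes a constant minus a monotone ratio.\<close>

lemma power_ge_tangent:
  fixes x u :: real
  assumes "0 \<le> x" "0 \<le> u"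
  shows "x ^ Suc q + real (Suc q) * x ^ q * (u - x) \<le> u ^ Suc q"
proof (induction q)
  case (Suc q)
  have "u * (x ^ Suc q + real (Suc q) * x ^ q * (u - x)) \<le> u * u ^ Suc q"
    using Suc assms(2) by (rule mult_left_mono)
  moreover have "u * (x ^ Suc q + real (Suc q) * x ^ q * (u - x))
      = x ^ Suc (Suc q) + real (Suc (Suc q)) * x ^ Suc q * (u - x) + real (Suc q) * x ^ q * (u - x)\<^sup>2"
    by (simp add: power2_eq_square algebra_simps)
  moreover have "0 \<le> real (Suc q) * x ^ q * (u - x)\<^sup>2"
    using assms by simp
  ultimately show ?case by simp
qed simp

text \<open>
  A lattice path from $(0,0)$ to $(a,b)$ has area $X$ on its left and $Y$ below it, $X + Y = ab$.
  For the path that goes up by $Y/a$, then right by $a$, then up again, \<open>turn_sum q a X Y\<close> is the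
  integral of $x^{q+1}$ over the vertical steps plus that of $y^{q+1}$ over the horizontal ones;
  \<open>turn_sum q b Y X\<close> belongs to the reflected path (right, up, right).
\<close>

definition turn_sum :: "nat \<Rightarrow> real \<Rightarrow> real \<Rightarrow> real \<Rightarrow> real" where
  "turn_sum q a X Y = a ^ q * X + Y ^ Suc q / a ^ q"

lemma turn_sum_param:
  assumes "a > 0"
  shows "turn_sum q a (a * b * l) (a * b * m) = a * b * (a ^ q * l + b ^ q * m ^ Suc q)"
  using assms unfolding turn_sum_def by (simp add: field_simps power_mult_distrib)

text \<open>
  A step upwards increases \<open>turn_sum q a X Y\<close> by exactly $a^{q+1}$. If the other candidate is the
  larger one, convexity in the step length bounds its growth from below by its derivative, and
  \<open>less\<close> together with Bernoulli's inequality bounds that derivative by $a^{q+1}$.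
\<close>

lemma turn_sum_step:
  fixes a b X Y :: real
  assumes q: "q \<ge> 1" and nn: "a \<ge> 0" "b \<ge> 0" "X \<ge> 0" "Y \<ge> 0" and XY: "X + Y = a * b"
    and less: "turn_sum q a X Y < turn_sum q b Y X"
  shows "turn_sum q b Y X + a ^ Suc q \<le> turn_sum q (b + 1) Y (X + a)"
proof -
  obtain m where m: "q = Suc m" using q by (cases q) auto
  \<comment> \<open>The strict hypothesis rules out a degenerate rectangle, where both sums are
    0.\<close>
  have "a * b \<noteq> 0"
  proof
    assume "a * b = 0"
    then have "X = 0" "Y = 0" using XY nn by auto
    then show False using less by (simp add: turn_sum_def)
  qed
  then have pos: "a > 0" "b > 0" using nn by auto
  \<comment> \<open>The share of the rectangle to the left of the path; in terms of it the
    hypothesis becomes \<open>act\<close>.\<close>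
  define l where "l = X / (a * b)"
  have X: "X = a * b * l" using pos by (simp add: l_def)
  have Y: "Y = a * b * (1 - l)" using XY X by (simp add: algebra_simps)
  have l0: "0 \<le> l" using pos nn by (simp add: l_def)
  have l1: "l \<le> 1" using XY nn pos by (simp add: l_def)
  have "a * b * (a ^ q * l + b ^ q * (1 - l) ^ Suc q) < a * b * (b ^ q * (1 - l) + a ^ q * l ^ Suc q)"
    using less turn_sum_param[OF pos(1), of q b l "1 - l"] turn_sum_param[OF pos(2), of q a "1 - l" l]
    unfolding X Y by (simp add: mult.commute)
  then have "a ^ q * l + b ^ q * (1 - l) ^ Suc q < b ^ q * (1 - l) + a ^ q * l ^ Suc q"
    using pos by simp
  then have act: "a ^ q * (l * (1 - l ^ q)) < b ^ q * ((1 - l) * (1 - (1 - l) ^ q))"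
    by (simp add: algebra_simps)
  have lpos: "l > 0" using act l0 by (cases "l = 0") auto
  have bern: "1 - (1 - l) ^ q \<le> real q * l"
    using power_ge_tangent[of 1 "1 - l" m] l1 by (simp add: m)
  have pl: "l ^ Suc q \<le> l ^ q" using l0 l1 by (simp add: power_Suc_le_self m mult_left_le_one_le)
  \<comment> \<open>Times \<open>a ^ Suc q\<close>, the left side is \<open>a ^ Suc q\<close> minus
    the growth of the convex term guaranteed by \<open>t2\<close>; this deficit has to be covered by
    the growth in \<open>t1\<close>.\<close>
  have "1 - real (Suc q) * l ^ q + real q * l ^ Suc q \<le> 1 - l ^ q"
    using mult_left_mono[OF pl, of "real q"] by (simp add: algebra_simps)
  then have "a ^ q * (l * (1 - real (Suc q) * l ^ q + real q * l ^ Suc q)) \<le> a ^ q * (l * (1 - l ^ q))"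
    using pos l0 by (intro mult_left_mono) auto
  also have "\<dots> \<le> b ^ q * ((1 - l) * (real q * l))"
    using act bern pos l1 by (smt (verit, best) mult_left_mono zero_le_power)
  finally have "l * (a ^ q * (1 - real (Suc q) * l ^ q + real q * l ^ Suc q)) \<le> l * (real q * b ^ q * (1 - l))"
    by (simp only: mult_ac)
  then have key: "a ^ q * (1 - real (Suc q) * l ^ q + real q * l ^ Suc q) \<le> real q * b ^ q * (1 - l)"
    using lpos by simp
  \<comment> \<open>The first horizontal run X / b of the reflected path; after the step it is (X +
    a) / (b + 1).\<close>
  define x where "x = a * l"
  have x0: "x \<ge> 0" using pos l0 by (simp add: x_def)
  have Xx: "X = x * b" by (simp add: x_def X)
  have t1: "(b ^ q + real q * b ^ m) * Y \<le> (b + 1) ^ q * Y"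
    using power_ge_tangent[of b "b + 1" m] pos nn unfolding m by (intro mult_right_mono) auto
  have "x ^ Suc q + real (Suc q) * x ^ q * ((X + a) / (b + 1) - x) \<le> ((X + a) / (b + 1)) ^ Suc q"
    using x0 nn by (intro power_ge_tangent) auto
  then have "(b + 1) * (x ^ Suc q + real (Suc q) * x ^ q * ((X + a) / (b + 1) - x))
      \<le> (b + 1) * ((X + a) / (b + 1)) ^ Suc q"
    using nn by (intro mult_left_mono) auto
  moreover have "(b + 1) * ((X + a) / (b + 1)) ^ Suc q = (X + a) ^ Suc q / (b + 1) ^ q"
    using nn by (simp add: power_divide)
  moreover have "(b + 1) * (x ^ Suc q + real (Suc q) * x ^ q * ((X + a) / (b + 1) - x))
     = (b + 1) * x ^ Suc q + real (Suc q) * x ^ q * ((X + a) - x * (b + 1))"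
    using nn by (simp add: field_simps)
  moreover have "\<dots> = b * x ^ Suc q + x ^ q * (real (Suc q) * a - real q * x)"
    by (simp add: Xx algebra_simps)
  ultimately have t2: "b * x ^ Suc q + x ^ q * (real (Suc q) * a - real q * x) \<le> (X + a) ^ Suc q / (b + 1) ^ q"
    by linarith
  have t3: "X ^ Suc q / b ^ q = b * x ^ Suc q" using pos by (simp add: Xx power_mult_distrib)
  have "a * (a ^ q * (1 - real (Suc q) * l ^ q + real q * l ^ Suc q)) \<le> a * (real q * b ^ q * (1 - l))"
    using key pos by simp
  then have "a ^ Suc q \<le> real q * b ^ m * Y + x ^ q * (real (Suc q) * a - real q * x)"
    unfolding Y x_def m by (simp add: algebra_simps power_mult_distrib)
  then show ?thesis using t1 t2 t3 unfolding turn_sum_def by (simp add: algebra_simps)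
qed

lemma turn_sum_exact:
  "turn_sum q a (X + a) Y = turn_sum q a X Y + a ^ Suc q"
  by (simp add: turn_sum_def algebra_simps)

lemma turn_sum_max_step:
  fixes a b X Y :: real
  assumes q: "q \<ge> 1" and nn: "a \<ge> 0" "b \<ge> 0" "X \<ge> 0" "Y \<ge> 0" and XY: "X + Y = a * b"
  shows "max (turn_sum q a X Y) (turn_sum q b Y X) + a ^ Suc q
       \<le> max (turn_sum q a (X + a) Y) (turn_sum q (b + 1) Y (X + a))"
  using turn_sum_step[OF assms] turn_sum_exact[of q a X Y] by linarith

lemma power_step_le:
  fixes a :: real
  assumes "a \<ge> 0"
  shows "a ^ Suc (Suc q) + real (Suc (Suc q)) * a ^ Suc q \<le> (a + 1) ^ Suc (Suc q)"
  using power_ge_tangent[of a "a + 1" "Suc q"] assms by simp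

text \<open>Each new summand is split: the power of the coordinate that moves telescopes by
  \<open>power_step_le\<close>, the power of the other is paid for by the growth of the maximum.
  Subtracting the triangular numbers, which depend only on the end point, leaves the areas
  \<open>X\<close> and \<open>Y\<close> on the two sides of the path.\<close>

lemma lattice_path_power_sum:
  fixes a b :: "nat \<Rightarrow> real"
  assumes q: "q \<ge> 1" and zero: "a 0 = 0" "b 0 = 0"
    and step: "\<And>i. a (Suc i) = a i + 1 \<and> b (Suc i) = b i \<or> a (Suc i) = a i \<and> b (Suc i) = b i + 1"
  defines "X \<equiv> \<lambda>n. (\<Sum>i<n. a i) - a n * (a n - 1) / 2"
    and "Y \<equiv> \<lambda>n. (\<Sum>i<n. b i) - b n * (b n - 1) / 2"
  shows "a n \<ge> 0 \<and> b n \<ge> 0 \<and> X n \<ge> 0 \<and> Y n \<ge> 0 \<and> X n + Y n = a n * b n \<and>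
     real (Suc (Suc q)) * (\<Sum>i<n. a i ^ Suc q + b i ^ Suc q)
     \<le> a n ^ Suc (Suc q) + b n ^ Suc (Suc q)
       + real (Suc (Suc q)) * max (turn_sum q (a n) (X n) (Y n)) (turn_sum q (b n) (Y n) (X n))"
proof (induction n)
  case 0
  then show ?case by (simp add: zero X_def Y_def turn_sum_def)
next
  case (Suc n)
  then have nn: "a n \<ge> 0" "b n \<ge> 0" "X n \<ge> 0" "Y n \<ge> 0" and XY: "X n + Y n = a n * b n" by auto
  let ?r = "real (Suc (Suc q))"
  let ?M = "\<lambda>n. max (turn_sum q (a n) (X n) (Y n)) (turn_sum q (b n) (Y n) (X n))"
  from step[of n] show ?case
  proof
    assume s: "a (Suc n) = a n + 1 \<and> b (Suc n) = b n"
    have X: "X (Suc n) = X n" and Y: "Y (Suc n) = Y n + b n"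
      using s by (simp_all add: X_def Y_def field_simps)
    \<comment> \<open>A step to the right is a step upwards of the reflected path, so the
      coordinates are exchanged.\<close>
    have "?M n + b n ^ Suc q \<le> ?M (Suc n)"
      using turn_sum_max_step[OF q nn(2,1,4,3)] XY s X Y by (simp add: ac_simps max.commute)
    then have "?r * (?M n + b n ^ Suc q) \<le> ?r * ?M (Suc n)"
      by (intro mult_left_mono) auto
    moreover have "a n ^ Suc (Suc q) + ?r * a n ^ Suc q \<le> (a n + 1) ^ Suc (Suc q)"
      using power_step_le nn by blast
    ultimately show ?thesis using Suc s X Y nn XY
      by (simp add: distrib_left algebra_simps del: power_Suc of_nat_Suc)
  next
    assume s: "a (Suc n) = a n \<and> b (Suc n) = b n + 1"
    have X: "X (Suc n) = X n + a n" and Y: "Y (Suc n) = Y n"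
      using s by (simp_all add: X_def Y_def field_simps)
    have "?M n + a n ^ Suc q \<le> ?M (Suc n)"
      using turn_sum_max_step[OF q nn XY] s X Y by simp
    then have "?r * (?M n + a n ^ Suc q) \<le> ?r * ?M (Suc n)"
      by (intro mult_left_mono) auto
    moreover have "b n ^ Suc (Suc q) + ?r * b n ^ Suc q \<le> (b n + 1) ^ Suc (Suc q)"
      using power_step_le nn by blast
    ultimately show ?thesis using Suc s X Y nn XY
      by (simp add: distrib_left algebra_simps del: power_Suc of_nat_Suc)
  qed
qed

section \<open>Quasi-stars and quasi-cliques\<close>

text \<open>
  The limiting density of $r$-cliques plus independent $r$-sets in a clique on $gn$ vertices together
  with $(1-g)n$ isolated vertices. The complement of that graph for $g = \sqrt{1-\rho}$
  (a quasi-star) has the same edge density $\rho$ as the quasi-clique for $g = \sqrt\rho$.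
\<close>

definition clique_density :: "nat \<Rightarrow> real \<Rightarrow> real" where
  "clique_density r g = g ^ r + (1 - g) ^ r + real r * g * (1 - g) ^ (r - 1)"

lemma power_shift_diff_mono:
  fixes u v :: real
  assumes "0 \<le> u" "u \<le> v"
  shows "(1 + u) ^ n - u ^ n \<le> (1 + v) ^ n - v ^ n"
proof (rule DERIV_nonneg_imp_nondecreasing[OF assms(2)])
  fix x :: real assume "u \<le> x" "x \<le> v"
  then have "x ^ (n - 1) \<le> (1 + x) ^ (n - 1)" using assms by (intro power_mono) auto
  moreover have "((\<lambda>x. (1 + x) ^ n - x ^ n) has_real_derivative
      real n * ((1 + x) ^ (n - 1) - x ^ (n - 1))) (at x)"
    by (auto intro!: derivative_eq_intros simp: algebra_simps)
  ultimately show "\<exists>y. ((\<lambda>x. (1 + x) ^ n - x ^ n) has_real_derivative y) (at x) \<and> 0 \<le> y"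
    by (intro exI conjI) auto
qed

lemma power_tangent_gap_nonneg:
  fixes u :: real
  assumes "0 \<le> u"
  shows "0 \<le> (1 + u) ^ Suc n - u ^ Suc n - real (Suc n) * u ^ n"
  using power_ge_tangent[of u "1 + u" n] assms by simp

text \<open>The derivative is a multiple of the same gap one degree lower, which is nonnegative by
  convexity.\<close>

lemma power_tangent_gap_mono:
  fixes u v :: real
  assumes "0 \<le> u" "u \<le> v"
  shows "(1 + u) ^ Suc (Suc n) - u ^ Suc (Suc n) - real (Suc (Suc n)) * u ^ Suc n
       \<le> (1 + v) ^ Suc (Suc n) - v ^ Suc (Suc n) - real (Suc (Suc n)) * v ^ Suc n"
    (is "?f u \<le> ?f v")
proof (rule DERIV_nonneg_imp_nondecreasing[OF assms(2)])
  fix x :: real assume x: "u \<le> x" "x \<le> v"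
  let ?d = "real (Suc (Suc n)) * ((1 + x) ^ Suc n - x ^ Suc n - real (Suc n) * x ^ n)"
  have "(?f has_real_derivative ?d) (at x)"
    by (rule derivative_eq_intros refl | simp add: algebra_simps del: power_Suc of_nat_Suc)+
  moreover have "0 \<le> ?d"
    using power_tangent_gap_nonneg[of x n] x assms by (intro mult_nonneg_nonneg) auto
  ultimately show "\<exists>y. (?f has_real_derivative y) (at x) \<and> 0 \<le> y" by blast
qed

text \<open>
  The difference of the two sides vanishes at both ends of $[0, \sqrt 2]$, and its derivative is
  a positive multiple of $w^q$ times a decreasing function, so it increases and then decreases.
\<close>

lemma star_le_clique_param:
  fixes w :: real and q :: nat
  assumes q: "q \<ge> 1" and w: "0 \<le> w" "w \<le> sqrt 2"
  defines "r \<equiv> real (Suc (Suc q))"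
  shows "1 + r * (w + w\<^sup>2 / 2) + (w + w\<^sup>2 / 2) ^ Suc (Suc q)
       \<le> (1 + w) ^ Suc (Suc q) + (w\<^sup>2 / 2) ^ Suc (Suc q) + r * (1 + w) * (w\<^sup>2 / 2) ^ Suc q"
proof -
  obtain m where m: "q = Suc m" using q by (cases q) auto
  define f where "f = (\<lambda>w::real. (1 + w) ^ Suc (Suc q) + (w\<^sup>2 / 2) ^ Suc (Suc q)
      + r * (1 + w) * (w\<^sup>2 / 2) ^ Suc q - 1 - r * (w + w\<^sup>2 / 2) - (w + w\<^sup>2 / 2) ^ Suc (Suc q))"
  \<comment> \<open>\<open>L\<close> is the derivative of \<open>f\<close> divided by r (1 + w).
    Writing w^2/2 = w (w/2) and w + w^2/2 = w (1 + w/2) lets w^q be factored out of it, which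
    produces \<open>P\<close> and \<open>k\<close>.\<close>
  define L where "L = (\<lambda>w::real. (1 + w) ^ q + (w\<^sup>2 / 2) ^ Suc q + real (Suc q) * w * (w\<^sup>2 / 2) ^ q
      - 1 - (w + w\<^sup>2 / 2) ^ Suc q)"
  define P where "P = (\<lambda>w::real. (1 + 1 / w) ^ q - (1 / w) ^ q)"
  define k where "k = (\<lambda>c::real. (1 + c) ^ Suc q - c ^ Suc q - real (Suc q) * c ^ q)"
  have deriv: "(f has_real_derivative r * (1 + x) * L x) (at x)" for x
  proof -
    have "(f has_real_derivative
       r * (1 + x) ^ Suc q + r * (x\<^sup>2 / 2) ^ Suc q * x
       + (r * (x\<^sup>2 / 2) ^ Suc q + r * (1 + x) * (real (Suc q) * (x\<^sup>2 / 2) ^ q * x))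
       - r * (1 + x) - r * (x + x\<^sup>2 / 2) ^ Suc q * (1 + x)) (at x)"
      unfolding f_def r_def
      by (rule derivative_eq_intros refl | simp add: algebra_simps del: power_Suc of_nat_Suc)+
    moreover have "r * (1 + x) ^ Suc q + r * (x\<^sup>2 / 2) ^ Suc q * x
       + (r * (x\<^sup>2 / 2) ^ Suc q + r * (1 + x) * (real (Suc q) * (x\<^sup>2 / 2) ^ q * x))
       - r * (1 + x) - r * (x + x\<^sup>2 / 2) ^ Suc q * (1 + x) = r * (1 + x) * L x"
    proof -
      define A where "A = (x\<^sup>2 / 2) ^ Suc q"
      define B where "B = real (Suc q) * (x\<^sup>2 / 2) ^ q"
      define C where "C = (x + x\<^sup>2 / 2) ^ Suc q"
      have Lx: "L x = (1 + x) ^ q + A + B * x - 1 - C"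
        by (simp add: L_def A_def B_def C_def)
      show ?thesis
        unfolding Lx A_def[symmetric] B_def[symmetric] C_def[symmetric] by (simp add: algebra_simps)
    qed
    ultimately show ?thesis by simp
  qed
  have factor: "L x = x ^ q * (P x - x * k (x / 2))" if "x > 0" for x
  proof -
    have a1: "x ^ q * P x = (1 + x) ^ q - 1"
    proof -
      have "x ^ q * (1 + 1 / x) ^ q = (x * (1 + 1 / x)) ^ q" by (simp add: power_mult_distrib)
      also have "x * (1 + 1 / x) = 1 + x" using that by (simp add: field_simps)
      finally have "x ^ q * (1 + 1 / x) ^ q = (1 + x) ^ q" .
      moreover have "x ^ q * (1 / x) ^ q = 1" using that by (simp add: power_divide)
      ultimately show ?thesis by (simp add: P_def right_diff_distrib)
    qed
    define u v where "u = 1 + x / 2" and "v = x / 2"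
    have a2: "x\<^sup>2 / 2 = x * v" "x + x * v = x * u"
      by (simp_all add: u_def v_def power2_eq_square algebra_simps)
    have kv: "k v = u ^ Suc q - v ^ Suc q - real (Suc q) * v ^ q"
      by (simp add: k_def u_def v_def)
    have "L x = x ^ q * P x - x ^ Suc q * k v"
      unfolding L_def a1 kv a2 power_mult_distrib by (simp add: algebra_simps)
    then show ?thesis by (simp add: v_def algebra_simps)
  qed
  have decr: "P y - y * k (y / 2) \<le> P x - x * k (x / 2)" if "0 < x" "x \<le> y" for x y
  proof -
    have "P y \<le> P x" unfolding P_def
      using that by (intro power_shift_diff_mono) (auto simp: frac_le)
    moreover have "x * k (x / 2) \<le> y * k (y / 2)"
      using that power_tangent_gap_mono[of "x / 2" "y / 2" m] power_tangent_gap_nonneg[of "x / 2" q]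
      unfolding k_def m by (intro mult_mono) auto
    ultimately show ?thesis by simp
  qed
  have L0: "L 0 = 0" using q by (simp add: L_def)
  have r0: "r \<ge> 0" by (simp add: r_def)
  have "0 \<le> f w"
  \<comment> \<open>The bracket in \<open>factor\<close> decreases, so a nonnegative
    \<open>L w\<close> stays nonnegative to the left of \<open>w\<close> and a negative one gives no
    positive value to the right; \<open>f\<close> is compared with its zero at that end.\<close>
  proof (cases "0 \<le> L w")
    case True
    have "f 0 \<le> f w"
    proof (rule DERIV_nonneg_imp_nondecreasing[OF w(1)])
      fix x assume x: "0 \<le> x" "x \<le> w"
      have "0 \<le> L x"
      proof (cases "x = 0")
        case False
        then have "0 < w" using x by simp
        then have "0 \<le> P w - w * k (w / 2)"
          using factor[of w] True by (smt (verit) mult_pos_neg zero_less_power)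
        then show ?thesis using factor[of x] decr[of x w] False x by simp
      qed (simp add: L0)
      then have "0 \<le> r * (1 + x) * L x" using r0 x by simp
      then show "\<exists>y. (f has_real_derivative y) (at x) \<and> 0 \<le> y"
        using deriv[of x] by blast
    qed
    moreover have "f 0 = 0" by (simp add: f_def)
    ultimately show ?thesis by simp
  next
    case False
    then have wpos: "w > 0" using L0 w by (cases "w = 0") auto
    have "f w \<ge> f (sqrt 2)"
    proof (rule DERIV_nonpos_imp_nonincreasing[OF w(2)])
      fix x assume x: "w \<le> x" "x \<le> sqrt 2"
      have "P w - w * k (w / 2) \<le> 0"
        using factor[of w] False wpos by (simp add: zero_le_mult_iff)
      then have "L x \<le> 0" using factor[of x] decr[of w x] x wpos by (simp add: mult_le_0_iff)
      then have "r * (1 + x) * L x \<le> 0"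
        using r0 x wpos by (intro mult_nonneg_nonpos) auto
      then show "\<exists>y. (f has_real_derivative y) (at x) \<and> y \<le> 0"
        using deriv[of x] by blast
    qed
    moreover have "f (sqrt 2) = 0"
    proof -
      have s2: "(sqrt 2)\<^sup>2 / 2 = (1 :: real)" by simp
      show ?thesis unfolding f_def s2 by (simp add: algebra_simps)
    qed
    ultimately show ?thesis by simp
  qed
  then show ?thesis by (simp add: f_def)
qed

text \<open>Division by 1 - e turns e, g and 1 - g into polynomials in one parameter w, running from
  0 (where e = 0) to sqrt 2 (where e = g). By homogeneity only the inequality
  \<open>star_le_clique_param\<close> is left.\<close>

lemma clique_density_star_le_clique:
  assumes q: "q \<ge> 1" and ge: "0 \<le> e" "e \<le> g" and sq: "g\<^sup>2 + e\<^sup>2 = 1"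
  shows "clique_density (Suc (Suc q)) e \<le> clique_density (Suc (Suc q)) g"
proof -
  have "2 * e\<^sup>2 \<le> 1" using ge sq power_mono[of e g 2] by linarith
  then have "e < 1" using one_le_power[of e 2] by linarith
  have g1: "g \<le> 1" using sq ge by (metis abs_le_square_iff abs_of_nonneg le_add_same_cancel1 one_power2 order_trans zero_le_power2)
  define A where "A = 1 - e"
  have A: "A > 0" using \<open>e < 1\<close> by (simp add: A_def)
  define w where "w = g / A - 1"
  have gA: "g = A * (1 + w)" using A by (simp add: w_def)
  have eA: "e = A * (w + w\<^sup>2 / 2)"
  proof -
    have "A * (A * (w + w\<^sup>2 / 2)) = ((A * (1 + w))\<^sup>2 - A\<^sup>2) / 2" by (simp add: power2_eq_square algebra_simps)
    also have "\<dots> = (1 - e\<^sup>2 - (1 - e)\<^sup>2) / 2" unfolding gA[symmetric] using sq by (simp add: A_def)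
    also have "\<dots> = A * e" by (simp add: A_def power2_eq_square field_simps)
    finally show ?thesis using A by simp
  qed
  have 1: "1 = A * (1 + w + w\<^sup>2 / 2)" using eA by (simp add: A_def algebra_simps)
  have gA': "1 - g = A * (w\<^sup>2 / 2)" using 1 gA by (simp add: algebra_simps)
  have w0: "w \<ge> 0"
  proof -
    have "g\<^sup>2 \<le> g" "e\<^sup>2 \<le> e" using ge g1 \<open>e < 1\<close> by (auto simp: power2_eq_square mult_left_le)
    then have "A \<le> g" using sq by (simp add: A_def)
    then show ?thesis using A by (simp add: w_def)
  qed
  have "A * (w\<^sup>2 / 2) \<le> A * 1" using gA' ge by (simp add: A_def)
  then have "w\<^sup>2 \<le> 2" using A by simp
  then have w2: "w \<le> sqrt 2" by (rule real_le_rsqrt)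
  let ?r = "Suc (Suc q)"
  have "clique_density ?r e = A ^ ?r * (1 + real ?r * (w + w\<^sup>2 / 2) + (w + w\<^sup>2 / 2) ^ ?r)"
  proof -
    define s where "s = w + w\<^sup>2 / 2"
    have "clique_density ?r e = (A * s) ^ ?r + A ^ ?r + real ?r * (A * s) * A ^ Suc q"
      unfolding clique_density_def s_def using eA by (simp add: A_def)
    then show ?thesis
      unfolding power_mult_distrib s_def[symmetric] by (simp add: algebra_simps)
  qed
  moreover have "clique_density ?r g = A ^ ?r * ((1 + w) ^ ?r + (w\<^sup>2 / 2) ^ ?r + real ?r * (1 + w) * (w\<^sup>2 / 2) ^ Suc q)"
  proof -
    have "clique_density ?r g = (A * (1 + w)) ^ ?r + (A * (w\<^sup>2 / 2)) ^ ?r + real ?r * (A * (1 + w)) * (A * (w\<^sup>2 / 2)) ^ Suc q"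
      unfolding clique_density_def gA' using gA by simp
    then show ?thesis unfolding power_mult_distrib by (simp add: algebra_simps)
  qed
  ultimately show ?thesis
    using star_le_clique_param[OF q w0 w2] A by (auto intro!: mult_left_mono)
qed

section \<open>Paths with two turns\<close>

text \<open>The trapezoidal rule overestimates the integral of a convex function, here of (q + 1)
  x^q over [y, b].\<close>

lemma power_trapezoid:
  fixes y b :: real
  assumes "0 \<le> y" "y \<le> b"
  shows "2 * (b ^ Suc q - y ^ Suc q) \<le> real (Suc q) * (b - y) * (b ^ q + y ^ q)"
proof (cases q)
  case (Suc m)
  define f where "f = (\<lambda>b::real. real (Suc q) * (b - y) * (b ^ q + y ^ q) - 2 * (b ^ Suc q - y ^ Suc q))"
  have "f y \<le> f b"
  proof (rule DERIV_nonneg_imp_nondecreasing[OF assms(2)])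
    fix x assume x: "y \<le> x" "x \<le> b"
    let ?d = "real (Suc q) * (y ^ q - (x ^ q + real q * x ^ m * (y - x)))"
    have "(f has_real_derivative ?d) (at x)"
      unfolding f_def Suc
      by (rule derivative_eq_intros refl | simp del: of_nat_Suc)+ (simp add: algebra_simps)
    moreover have "0 \<le> ?d"
      using power_ge_tangent[of x y m] x assms unfolding Suc by (intro mult_nonneg_nonneg) auto
    ultimately show "\<exists>y. (f has_real_derivative y) (at x) \<and> 0 \<le> y" by blast
  qed
  then show ?thesis by (simp add: f_def)
qed simp

text \<open>This is the numerator of the quotient rule in \<open>tangent_gap_ratio_mono\<close>,
  with \<open>c\<close> the derivative of \<open>z\<close>.\<close>

lemma tangent_gap_ratio_deriv_nonneg:
  fixes y z c :: real and m :: nat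
  defines "b \<equiv> y + z" and "q \<equiv> Suc m"
  assumes "0 \<le> y" "0 \<le> z" "0 \<le> c" "c \<le> 2"
  shows "0 \<le> real (Suc q) * z * (b ^ q - y ^ q) - real (Suc q) * real q * z\<^sup>2 * y ^ m * (1 - c)
           - c * (b ^ Suc q - y ^ Suc q - real (Suc q) * z * y ^ q)"
proof -
  \<comment> \<open>The expression is affine in \<open>c\<close>; at \<open>c = 0\<close> it is a tangent inequality and at \<open>c = 2\<close> the trapezoidal rule.\<close>
  define T0 where "T0 = real (Suc q) * z * (b ^ q - (y ^ q + real q * y ^ m * (b - y)))"
  define T2 where "T2 = (real (Suc q) * (b - y) * (b ^ q + y ^ q) - 2 * (b ^ Suc q - y ^ Suc q))
     + real (Suc q) * real q * z\<^sup>2 * y ^ m"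
  have "0 \<le> T0"
    unfolding T0_def using power_ge_tangent[of y b m] assms by (intro mult_nonneg_nonneg) auto
  moreover have "0 \<le> real (Suc q) * real q * z\<^sup>2 * y ^ m" using assms by simp
  then have "0 \<le> T2"
    unfolding T2_def using power_trapezoid[of y b q] assms by simp
  ultimately have "0 \<le> (1 - c / 2) * T0 + (c / 2) * T2"
    using assms by simp
  also have "\<dots> = real (Suc q) * z * (b ^ q - y ^ q) - real (Suc q) * real q * z\<^sup>2 * y ^ m * (1 - c)
           - c * (b ^ Suc q - y ^ Suc q - real (Suc q) * z * y ^ q)"
  proof -
    define B C D where "B = b ^ q" and "C = y ^ q" and "D = y ^ m"
    define B' C' where "B' = b ^ Suc q" and "C' = y ^ Suc q"
    have z: "b - y = z" by (simp add: b_def)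
    show ?thesis
      unfolding T0_def T2_def z B'_def[symmetric] C'_def[symmetric]
      unfolding B_def[symmetric] C_def[symmetric] D_def[symmetric]
      by (simp add: field_simps power2_eq_square del: of_nat_Suc)
  qed
  finally show ?thesis .
qed

text \<open>An up-right-up path of density \<open>\<rho>\<close>, rescaled to horizontal length 1,
  has first vertical piece \<open>y\<close>, last one \<open>z\<close> and height \<tau> - 1.
  \<open>Z\<close> is the gap between u^(q+1) at the full height and its tangent at
  \<open>y\<close>. The bound 2 on \<rho> \<tau> is the range of \<open>c\<close> in the preceding
  lemma.\<close>

lemma tangent_gap_ratio_mono:
  fixes \<rho> s t :: real and q :: nat
  defines "z \<equiv> \<lambda>\<tau>. (\<rho> * \<tau>\<^sup>2 - 1) / 2"
  defines "y \<equiv> \<lambda>\<tau>. \<tau> - 1 - z \<tau>"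
  defines "Z \<equiv> \<lambda>\<tau>. (\<tau> - 1) ^ Suc q - y \<tau> ^ Suc q - real (Suc q) * z \<tau> * y \<tau> ^ q"
  assumes q: "q \<ge> 1" and st: "s \<le> t"
    and range: "\<And>\<tau>. s \<le> \<tau> \<Longrightarrow> \<tau> \<le> t \<Longrightarrow> 0 < z \<tau> \<and> 0 \<le> y \<tau> \<and> 0 \<le> \<rho> * \<tau> \<and> \<rho> * \<tau> \<le> 2"
  shows "Z s / z s \<le> Z t / z t"
proof (rule DERIV_nonneg_imp_nondecreasing[OF st])
  obtain m where m: "q = Suc m" using q by (cases q) auto
  fix x assume x: "s \<le> x" "x \<le> t"
  define c where "c = \<rho> * x"
  have r: "0 < z x" "0 \<le> y x" "0 \<le> c" "c \<le> 2" using range[OF x] by (auto simp: c_def)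
  have b: "x - 1 = y x + z x" by (simp add: y_def)
  have dz: "(z has_real_derivative c) (at x)"
    unfolding z_def c_def by (auto intro!: derivative_eq_intros)
  have dy: "(y has_real_derivative 1 - c) (at x)"
    unfolding y_def by (auto intro!: derivative_eq_intros dz)
  let ?p = "real (Suc q)"
  define Z' where "Z' = ?p * (x - 1) ^ q - ?p * y x ^ q * (1 - c)
     - ?p * (c * y x ^ q + z x * (real q * y x ^ m * (1 - c)))"
  have "(Z has_real_derivative Z') (at x)"
    unfolding Z_def Z'_def m
    by (rule derivative_eq_intros dz dy refl | simp add: algebra_simps del: of_nat_Suc)+
  then have "((\<lambda>x. Z x / z x) has_real_derivative (Z' * z x - Z x * c) / (z x * z x)) (at x)"
    using dz r by (intro DERIV_divide) auto
  moreover have "Z' * z x - Z x * c = ?p * z x * ((y x + z x) ^ q - y x ^ q)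
      - ?p * real q * (z x)\<^sup>2 * y x ^ m * (1 - c)
      - c * ((y x + z x) ^ Suc q - y x ^ Suc q - ?p * z x * y x ^ q)"
  proof -
    define B C D where "B = (y x + z x) ^ q" and "C = y x ^ q" and "D = y x ^ m"
    define B' C' where "B' = (y x + z x) ^ Suc q" and "C' = y x ^ Suc q"
    show ?thesis
      unfolding Z'_def Z_def b B'_def[symmetric] C'_def[symmetric]
      unfolding B_def[symmetric] C_def[symmetric] D_def[symmetric]
      by (simp add: algebra_simps power2_eq_square del: of_nat_Suc)
  qed
  moreover have "0 \<le> \<dots>"
    using tangent_gap_ratio_deriv_nonneg[of "y x" "z x" c m] r unfolding m by simp
  ultimately show "\<exists>D. ((\<lambda>x. Z x / z x) has_real_derivative D) (at x) \<and> 0 \<le> D"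
    by (metis divide_nonneg_nonneg zero_le_square)
qed

text \<open>
  Up-right-up paths of fixed edge density $\rho$ and total length $1$, parametrised by their horizontal
  length $t$; \<open>y\<close> is the length of the first vertical piece. The end points $t = \sqrt\rho$ and
  $t = 1 - \sqrt{1-\rho}$ are the quasi-clique and the quasi-star. In the scale-free variable
  $\tau = 1/t$ the sign of the derivative of \<open>N\<close> is that of $q$ minus a nondecreasing function of
  $\tau$, so \<open>N\<close> decreases and then increases.
\<close>

lemma one_turn_le_endpoints:
  fixes \<rho> t :: real
  assumes q: "q \<ge> 1" and \<rho>: "0 < \<rho>" "\<rho> \<le> 1"
    and t: "1 - sqrt (1 - \<rho>) \<le> t" "t \<le> sqrt \<rho>"
  defines "r \<equiv> Suc (Suc q)"
  defines "y \<equiv> \<lambda>t. 1 - t / 2 - \<rho> / (2 * t)"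
  defines "N \<equiv> \<lambda>t. t ^ r + (1 - t) ^ r + real r * (t ^ q * (\<rho> - t\<^sup>2) / 2 + t * y t ^ Suc q)"
  shows "N t \<le> max (clique_density r (sqrt \<rho>)) (clique_density r (sqrt (1 - \<rho>)))"
proof -
  obtain m where m: "q = Suc m" using q by (cases q) auto
  define e where "e = sqrt (1 - \<rho>)"
  define g where "g = sqrt \<rho>"
  have e: "0 \<le> e" "e < 1" "e\<^sup>2 = 1 - \<rho>" using \<rho> by (auto simp: e_def)
  have g: "0 < g" "g\<^sup>2 = \<rho>" using \<rho> by (auto simp: g_def)
  define z where "z = (\<lambda>\<tau>. (\<rho> * \<tau>\<^sup>2 - 1) / 2)"
  define w where "w = (\<lambda>\<tau>. \<tau> - 1 - z \<tau>)"
  define Z where "Z = (\<lambda>\<tau>. (\<tau> - 1) ^ Suc q - w \<tau> ^ Suc q - real (Suc q) * z \<tau> * w \<tau> ^ q)"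
  have zt: "\<rho> - x\<^sup>2 = 2 * x\<^sup>2 * z (1 / x)" if "x > 0" for x
    using that by (simp add: z_def power_divide field_simps)
  have yt: "y x = x * w (1 / x)" if "x > 0" for x
    using that by (simp add: y_def w_def z_def power2_eq_square field_simps)
  have deriv: "(N has_real_derivative real r * x ^ Suc q * (real q * z (1 / x) - Z (1 / x))) (at x)"
    if x: "x > 0" for x
  proof -
    have dy: "(y has_real_derivative z (1 / x)) (at x)"
      unfolding y_def z_def using x
      by (auto intro!: derivative_eq_intros simp: power2_eq_square field_simps)
    have "(N has_real_derivative
      real r * x ^ Suc q - real r * (1 - x) ^ Suc q
      + real r * ((real q * x ^ m * (\<rho> - x\<^sup>2) - x ^ q * (2 * x)) / 2
         + (y x ^ Suc q + x * (real (Suc q) * y x ^ q * z (1 / x))))) (at x)"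
      unfolding N_def r_def m
      by (rule derivative_eq_intros dy refl | simp add: field_simps power2_eq_square del: of_nat_Suc)+
    moreover have "real r * x ^ Suc q - real r * (1 - x) ^ Suc q
      + real r * ((real q * x ^ m * (\<rho> - x\<^sup>2) - x ^ q * (2 * x)) / 2
         + (y x ^ Suc q + x * (real (Suc q) * y x ^ q * z (1 / x))))
      = real r * x ^ Suc q * (real q * z (1 / x) - Z (1 / x))"
    proof -
      have b: "(1 - x) ^ Suc q = x ^ Suc q * (1 / x - 1) ^ Suc q"
        using x unfolding power_mult_distrib[symmetric] by (simp add: right_diff_distrib)
      have y1: "y x ^ Suc q = x ^ Suc q * w (1 / x) ^ Suc q"
        unfolding yt[OF x] by (rule power_mult_distrib)
      have y2: "x * (real (Suc q) * y x ^ q * z (1 / x)) = x ^ Suc q * (real (Suc q) * z (1 / x) * w (1 / x) ^ q)"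
        unfolding yt[OF x] power_mult_distrib by simp
      have z1: "(real q * x ^ m * (\<rho> - x\<^sup>2) - x ^ q * (2 * x)) / 2 = x ^ Suc q * (real q * z (1 / x)) - x ^ Suc q"
        unfolding zt[OF x] m by (simp add: power2_eq_square field_simps)
      show ?thesis
        unfolding b y1 y2 z1 Z_def by (simp add: algebra_simps del: power_Suc of_nat_Suc)
    qed
    ultimately show ?thesis by simp
  qed
  have range: "0 < z \<tau> \<and> 0 \<le> w \<tau> \<and> 0 \<le> \<rho> * \<tau> \<and> \<rho> * \<tau> \<le> 2"
    if \<tau>: "1 / x \<le> \<tau>" "\<tau> \<le> 1 / (1 - e)" and x: "0 < x" "x < g" for \<tau> x
  proof (intro conjI)
    have "0 < 1 / x" using x by simp
    then have \<tau>0: "\<tau> > 0" using \<tau> by linarith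
    define u where "u = 1 / \<tau>"
    have \<tau>u: "\<tau> = 1 / u" and u0: "u > 0" using \<tau>0 by (auto simp: u_def)
    have u: "u < g" "1 - e \<le> u"
      using \<tau> x e u0 by (auto simp: \<tau>u field_simps)
    have g1: "g \<le> 1" using \<rho> by (simp add: g_def)
    have "u\<^sup>2 < \<rho>" using u u0 g by (metis less_imp_le power_strict_mono zero_less_numeral)
    then have "0 < 2 * u\<^sup>2 * z (1 / u)" using zt[OF u0] by linarith
    then have "0 < z (1 / u)" by (rule zero_less_mult_pos) (use u0 in simp)
    then show "0 < z \<tau>" by (simp add: \<tau>u)
    \<comment> \<open>As 1 - \<rho> = e^2, the quantity 2 u y(u) equals e^2 - (1 - u)^2.\<close>
    have "(1 - u)\<^sup>2 \<le> e\<^sup>2" using u g1 by (intro power_mono) auto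
    moreover have "2 * u * y u = 2 * u - u\<^sup>2 - \<rho>"
      using u0 by (simp add: y_def power2_eq_square field_simps)
    ultimately have "0 \<le> 2 * u * y u" using e by (simp add: power2_eq_square algebra_simps)
    then show "0 \<le> w \<tau>" using yt[OF u0] u0 by (simp add: \<tau>u zero_le_mult_iff)
    show "0 \<le> \<rho> * \<tau>" using \<rho> \<tau>0 by simp
    \<comment> \<open>The lower end of the range, u \<ge> 1 - e, gives \<rho> / u \<le> 1 +
      e.\<close>
    have "\<rho> = (1 - e) * (1 + e)" using e by (simp add: power2_eq_square algebra_simps)
    also have "\<dots> \<le> u * 2" using u e by (intro mult_mono) auto
    finally show "\<rho> * \<tau> \<le> 2" using u0 by (simp add: \<tau>u field_simps)
  qed
  have mono: "Z (1 / x') / z (1 / x') \<le> Z (1 / x) / z (1 / x)"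
    if "1 - e \<le> x" "x \<le> x'" "x' < g" for x x'
  proof -
    have "1 / x' \<le> 1 / x" "1 / x \<le> 1 / (1 - e)" using that e by (auto intro!: frac_le)
    then show ?thesis
      unfolding Z_def w_def z_def
      using that e by (intro tangent_gap_ratio_mono[OF q] range[of x', unfolded w_def z_def]) auto
  qed
  have Ng: "N g = clique_density r g"
  proof -
    have yg: "y g = 1 - g" using g by (simp add: y_def power2_eq_square field_simps)
    show ?thesis
      unfolding N_def yg clique_density_def r_def using g by (simp add: algebra_simps)
  qed
  have Ne: "N (1 - e) = clique_density r e"
  proof -
    have "2 * (1 - e) * y (1 - e) = 0"
      using e by (simp add: y_def power2_eq_square field_simps)
    then have y0: "y (1 - e) = 0" using e by simp
    have "\<rho> - (1 - e)\<^sup>2 = 2 * e * (1 - e)" using e by (simp add: power2_eq_square algebra_simps)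
    then have "N (1 - e) = (1 - e) ^ r + e ^ r + real r * ((1 - e) ^ q * (2 * e * (1 - e)) / 2)"
      by (simp add: N_def y0)
    also have "(1 - e) ^ q * (2 * e * (1 - e)) / 2 = e * (1 - e) ^ Suc q" by simp
    finally show ?thesis by (simp add: clique_density_def r_def)
  qed
  have t': "1 - e \<le> t" "t \<le> g" using t by (auto simp: e_def g_def)
  have t0: "t > 0" using t' e by linarith
  \<comment> \<open>By \<open>mono\<close> the sign of the derivative at \<open>t\<close>
    propagates: a nonpositive one to all smaller arguments, a nonnegative one to all larger ones
    below \<open>g\<close>.\<close>
  consider "t = g" | "t < g" "real q \<le> Z (1 / t) / z (1 / t)" | "t < g" "Z (1 / t) / z (1 / t) \<le> real q"
    using t' by linarith
  then have "N t \<le> max (N g) (N (1 - e))"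
  proof cases
    case 2
    have "N (1 - e) \<ge> N t"
    proof (rule DERIV_nonpos_imp_nonincreasing[OF t'(1)])
      fix x assume x: "1 - e \<le> x" "x \<le> t"
      have x0: "x > 0" using x e by linarith
      have "1 / x \<le> 1 / (1 - e)" using x e by (intro frac_le) auto
      then have zpos: "z (1 / x) > 0" using range[of x "1 / x"] x x0 2 by simp
      have "real q \<le> Z (1 / x) / z (1 / x)" using mono[OF x 2(1)] 2 by linarith
      then have "real q * z (1 / x) - Z (1 / x) \<le> 0" using zpos by (simp add: field_simps)
      then have "real r * x ^ Suc q * (real q * z (1 / x) - Z (1 / x)) \<le> 0"
        using x0 by (intro mult_nonneg_nonpos) auto
      then show "\<exists>d. (N has_real_derivative d) (at x) \<and> d \<le> 0" using deriv[OF x0] by blast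
    qed
    then show ?thesis by simp
  next
    case 3
    have "N t \<le> N g"
    proof (rule DERIV_nonneg_imp_nondecreasing[OF t'(2)])
      fix x assume x: "t \<le> x" "x \<le> g"
      have x0: "x > 0" using x t0 by linarith
      have "0 \<le> real q * z (1 / x) - Z (1 / x)"
      \<comment> \<open>At \<open>g\<close> the denominator \<open>z\<close> vanishes and the ratio
        carries no information, but \<open>Z\<close> vanishes there as well.\<close>
      proof (cases "x = g")
        case True
        then have "z (1 / x) = 0" using g \<rho> by (simp add: z_def power_divide)
        then show ?thesis by (simp add: Z_def w_def)
      next
        case False
        then have xg: "x < g" using x by simp
        have "1 / x \<le> 1 / (1 - e)" using x e t' by (intro frac_le) auto
        then have zpos: "z (1 / x) > 0" using range[of x "1 / x"] x0 xg by simp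
        have "Z (1 / x) / z (1 / x) \<le> real q" using mono[OF t'(1) x(1) xg] 3 by linarith
        then show ?thesis using zpos by (simp add: field_simps)
      qed
      then have "0 \<le> real r * x ^ Suc q * (real q * z (1 / x) - Z (1 / x))"
        using x0 by (intro mult_nonneg_nonneg) auto
      then show "\<exists>d. (N has_real_derivative d) (at x) \<and> 0 \<le> d" using deriv[OF x0] by blast
    qed
    then show ?thesis by simp
  qed simp
  then show ?thesis by (simp add: Ng Ne g_def[symmetric] e_def[symmetric])
qed

text \<open>\<open>\<rho>\<close> and 1 - \<rho> are A^2 + 2X and B^2 + 2Y, twice the areas
  belonging to edges and non-edges. Nonnegativity of \<open>X\<close> and \<open>Y\<close> therefore
  says exactly that \<open>A\<close> lies in the interval required by
  \<open>one_turn_le_endpoints\<close>.\<close>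

lemma turn_sum_le_clique_density:
  fixes A B X Y :: real
  assumes q: "q \<ge> 1" and nn: "A \<ge> 0" "B \<ge> 0" "X \<ge> 0" "Y \<ge> 0"
    and AB: "A + B = 1" and XY: "X + Y = A * B"
  defines "r \<equiv> Suc (Suc q)" and "\<rho> \<equiv> A\<^sup>2 + 2 * X"
  shows "A ^ r + B ^ r + real r * turn_sum q A X Y
       \<le> max (clique_density r (sqrt \<rho>)) (clique_density r (sqrt (1 - \<rho>)))"
proof (cases "A = 0")
  case True
  then have "B = 1" "X = 0" "Y = 0" using AB XY nn by auto
  then show ?thesis using True q by (simp add: r_def \<rho>_def turn_sum_def clique_density_def)
next
  case False
  then have A: "A > 0" using nn by simp
  have B: "B = 1 - A" using AB by simp
  have Y: "Y = A * B - X" using XY by simp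
  have \<rho>': "1 - \<rho> = B\<^sup>2 + 2 * Y" unfolding \<rho>_def Y B by (simp add: power2_eq_square algebra_simps)
  have "0 \<le> 1 - \<rho>" unfolding \<rho>' using nn by simp
  then have \<rho>: "0 < \<rho>" "\<rho> \<le> 1" using A nn by (auto simp: \<rho>_def add_pos_nonneg)
  have "B \<le> sqrt (1 - \<rho>)" unfolding \<rho>' using nn by (intro real_le_rsqrt) auto
  then have t1: "1 - sqrt (1 - \<rho>) \<le> A" using B by simp
  have t2: "A \<le> sqrt \<rho>" unfolding \<rho>_def using nn by (intro real_le_rsqrt) auto
  define y where "y = 1 - A / 2 - \<rho> / (2 * A)"
  have yY: "Y = A * y" unfolding y_def \<rho>_def Y B using A by (simp add: power2_eq_square field_simps)
  have "turn_sum q A X Y = A ^ q * (\<rho> - A\<^sup>2) / 2 + A * y ^ Suc q"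
    unfolding turn_sum_def yY power_mult_distrib using A by (simp add: \<rho>_def)
  then show ?thesis
    using one_turn_le_endpoints[OF q \<rho> t1 t2] by (simp add: r_def B y_def)
qed

text \<open>Reflection exchanges \<open>A\<close> with \<open>B\<close>, \<open>X\<close> with
  \<open>Y\<close> and \<open>\<rho>\<close> with 1 - \<rho>, and the bound is symmetric under this.
  Of the two radii the larger one wins by \<open>clique_density_star_le_clique\<close>.\<close>

lemma turn_sums_le_clique_density:
  fixes A B X Y :: real
  assumes q: "q \<ge> 1" and nn: "A \<ge> 0" "B \<ge> 0" "X \<ge> 0" "Y \<ge> 0"
    and AB: "A + B = 1" and XY: "X + Y = A * B"
  defines "r \<equiv> Suc (Suc q)" and "\<rho> \<equiv> A\<^sup>2 + 2 * X"
  shows "A ^ r + B ^ r + real r * max (turn_sum q A X Y) (turn_sum q B Y X)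
       \<le> clique_density r (max (sqrt \<rho>) (sqrt (1 - \<rho>)))"
proof -
  have \<rho>': "1 - \<rho> = B\<^sup>2 + 2 * Y"
  proof -
    have "1 = A\<^sup>2 + B\<^sup>2 + 2 * (A * B)" using power2_sum[of A B] AB by (simp add: mult.assoc)
    then show ?thesis unfolding \<rho>_def XY[symmetric] by simp
  qed
  have \<rho>: "0 \<le> \<rho>" "0 \<le> 1 - \<rho>" using \<rho>' nn unfolding \<rho>_def by simp_all
  have 1: "A ^ r + B ^ r + real r * turn_sum q A X Y
       \<le> max (clique_density r (sqrt \<rho>)) (clique_density r (sqrt (1 - \<rho>)))"
    unfolding r_def \<rho>_def using turn_sum_le_clique_density[OF q nn AB XY] .
  have "B ^ r + A ^ r + real r * turn_sum q B Y X
       \<le> max (clique_density r (sqrt (1 - \<rho>))) (clique_density r (sqrt (1 - (1 - \<rho>))))"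
    unfolding r_def \<rho>' using turn_sum_le_clique_density[OF q nn(2,1,4,3)] AB XY by (simp add: ac_simps)
  then have "A ^ r + B ^ r + real r * max (turn_sum q A X Y) (turn_sum q B Y X)
       \<le> max (clique_density r (sqrt \<rho>)) (clique_density r (sqrt (1 - \<rho>)))"
    using 1 by (cases "turn_sum q A X Y \<le> turn_sum q B Y X")
      (auto simp: max_absorb1 max_absorb2 max.commute add.commute)
  also have "\<dots> \<le> clique_density r (max (sqrt \<rho>) (sqrt (1 - \<rho>)))"
  proof (cases "sqrt \<rho> \<le> sqrt (1 - \<rho>)")
    case True
    then show ?thesis
      using clique_density_star_le_clique[OF q, of "sqrt \<rho>" "sqrt (1 - \<rho>)"] \<rho>
      by (simp add: r_def max_absorb2)
  next
    case False
    then show ?thesis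
      using clique_density_star_le_clique[OF q, of "sqrt (1 - \<rho>)" "sqrt \<rho>"] \<rho>
      by (simp add: r_def max_absorb1)
  qed
  finally show ?thesis .
qed

section \<open>Shifting and threshold graphs\<close>

text \<open>With adjacency or its negation for \<open>P\<close> this covers cliques and independent
  sets, so each counting argument is made once.\<close>

definition pairwise_sets :: "nat \<Rightarrow> 'a set \<Rightarrow> ('a \<Rightarrow> 'a \<Rightarrow> bool) \<Rightarrow> 'a set set" where
  "pairwise_sets r V P = {R \<in> nsets V r. pairwise P R}"

lemma num_cliques_eq: "num_cliques r V E = card (pairwise_sets r V (\<lambda>v w. {v, w} \<in> E))"
  unfolding num_cliques_def pairwise_sets_def clique_def pairwise_def
  by (intro arg_cong[where f = card]) auto

lemma num_indeps_eq: "num_indeps r V E = card (pairwise_sets r V (\<lambda>v w. {v, w} \<notin> E))"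
  unfolding num_indeps_def pairwise_sets_def indep_def pairwise_def
  by (intro arg_cong[where f = card]) auto

lemma finite_pairwise_sets: "finite V \<Longrightarrow> finite (pairwise_sets r V P)"
  unfolding pairwise_sets_def by (simp add: finite_imp_finite_nsets)

text \<open>A set that survives is kept, any other has \<open>j\<close> replaced by
  \<open>i\<close>. A lost set contains \<open>j\<close>, not \<open>i\<close>, and a vertex related
  to \<open>j\<close> but not to \<open>i\<close>; so its replacement was not counted before, which
  makes the map injective.\<close>

lemma card_pairwise_sets_shift:
  assumes fin: "finite V" and ij: "i \<in> V" "j \<in> V" "i \<noteq> j"
    and sym: "\<And>x y. P x y = P y x" "\<And>x y. P' x y = P' y x"
    and off: "\<And>x y. x \<notin> {i, j} \<Longrightarrow> y \<notin> {i, j} \<Longrightarrow> P' x y = P x y"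
    and eq: "P' i j = P i j"
    and wi: "\<And>w. w \<notin> {i, j} \<Longrightarrow> P' w i \<longleftrightarrow> P w i \<or> P w j"
    and wj: "\<And>w. w \<notin> {i, j} \<Longrightarrow> P' w j \<longleftrightarrow> P w i \<and> P w j"
  shows "card (pairwise_sets r V P) \<le> card (pairwise_sets r V P')"
proof -
  let ?sw = "\<lambda>R. insert i (R - {j})"
  define f where "f = (\<lambda>R. if pairwise P' R then R else ?sw R)"
  have blocked: "j \<in> R \<and> i \<notin> R \<and> pairwise P' (?sw R) \<and> \<not> pairwise P (?sw R)"
    if R: "pairwise P R" "\<not> pairwise P' R" for R
  proof -
    obtain x y where xy: "x \<in> R" "y \<in> R" "x \<noteq> y" "\<not> P' x y"
      using R(2) by (auto simp: pairwise_def)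
    have Pxy: "P x y" using R(1) xy by (auto simp: pairwise_def)
    have *: "\<exists>w\<in>R. w \<notin> {i, j} \<and> j \<in> R \<and> \<not> P w i"
      if b: "b \<in> {i, j}" and ab: "a \<in> R" "b \<in> R" "a \<noteq> b" "P a b" "\<not> P' a b" for a b
    proof -
      have a: "a \<notin> {i, j}" using b ab eq sym by auto
      then have "b = j" using b ab wi[of a] by auto
      then show ?thesis using a ab wj[of a] by blast
    qed
    have "x \<in> {i, j} \<or> y \<in> {i, j}" using off[of x y] Pxy xy by blast
    then obtain w where w: "w \<in> R" "w \<notin> {i, j}" "j \<in> R" "\<not> P w i"
      using *[of y x] *[of x y] xy Pxy sym by metis
    have iR: "i \<notin> R" using R(1) w by (auto simp: pairwise_def)
    have "pairwise P' (?sw R)"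
      unfolding pairwise_def
    proof (intro ballI impI)
      fix a b assume ab: "a \<in> ?sw R" "b \<in> ?sw R" "a \<noteq> b"
      have *: "P u v" if "u \<in> R" "v \<in> R" "u \<noteq> v" for u v
        using that R(1) by (auto simp: pairwise_def)
      show "P' a b"
        using ab iR *[of a b] *[of a j] *[of b j] w(3) off[of a b] wi[of a] wi[of b] sym by auto
    qed
    moreover have "\<not> pairwise P (?sw R)"
      using w by (auto simp: pairwise_def)
    ultimately show ?thesis using w iR by simp
  qed
  show ?thesis
  proof (rule card_inj_on_le)
    show "finite (pairwise_sets r V P')" by (rule finite_pairwise_sets[OF fin])
    show "f ` pairwise_sets r V P \<subseteq> pairwise_sets r V P'"
    proof
      fix S assume "S \<in> f ` pairwise_sets r V P"
      then obtain R where R: "R \<in> nsets V r" "pairwise P R" and S: "S = f R"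
        by (auto simp: pairwise_sets_def)
      show "S \<in> pairwise_sets r V P'"
      proof (cases "pairwise P' R")
        case False
        have b: "j \<in> R" "i \<notin> R" "pairwise P' (?sw R)" using blocked[OF R(2) False] by auto
        have "finite R" "R \<subseteq> V" "card R = r" using R by (auto simp: nsets_def)
        moreover from this have "card R > 0" using b by (auto simp: card_gt_0_iff)
        ultimately have "?sw R \<in> nsets V r"
          using b ij by (auto simp: nsets_def card_Diff_singleton)
        then show ?thesis using False b by (simp add: S f_def pairwise_sets_def)
      qed (use R S in \<open>simp add: f_def pairwise_sets_def\<close>)
    qed
    show "inj_on f (pairwise_sets r V P)"
    proof (rule inj_onI)
      fix R S assume "R \<in> pairwise_sets r V P" "S \<in> pairwise_sets r V P" and fRS: "f R = f S"
      then have RS: "pairwise P R" "pairwise P S" by (auto simp: pairwise_sets_def)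
      show "R = S"
        using fRS blocked[OF RS(1)] blocked[OF RS(2)] RS
        by (cases "pairwise P' R"; cases "pairwise P' S") (auto simp: f_def)
    qed
  qed
qed

text \<open>An edge whose image is already present stays where it is; otherwise edges would
  merge.\<close>

definition moved_edges :: "'a \<Rightarrow> 'a \<Rightarrow> 'a set set \<Rightarrow> 'a set set" where
  "moved_edges i j E = {e \<in> E. j \<in> e \<and> i \<notin> e \<and> insert i (e - {j}) \<notin> E}"

text \<open>The compression operator of extremal set theory, applied to a family of pairs.\<close>

definition shift_edges :: "'a \<Rightarrow> 'a \<Rightarrow> 'a set set \<Rightarrow> 'a set set" where
  "shift_edges i j E = (E - moved_edges i j E) \<union> (\<lambda>e. insert i (e - {j})) ` moved_edges i j E"

lemma inj_on_moved: "inj_on (\<lambda>e. insert i (e - {j})) (moved_edges i j E)"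
  by (rule inj_onI) (auto simp: moved_edges_def)

text \<open>Used with constant weight 1 for the number of edges, and with the total rank of an edge
  for the termination of shifting.\<close>

lemma shift_edges_sum:
  fixes g :: "'a set \<Rightarrow> nat"
  assumes "finite E"
  shows "sum g (shift_edges i j E)
       = sum g (E - moved_edges i j E) + (\<Sum>e\<in>moved_edges i j E. g (insert i (e - {j})))"
proof -
  have "sum g (shift_edges i j E) = sum g (E - moved_edges i j E)
      + sum g ((\<lambda>e. insert i (e - {j})) ` moved_edges i j E)"
    unfolding shift_edges_def using assms
    by (intro sum.union_disjoint) (auto simp: moved_edges_def)
  then show ?thesis by (simp add: sum.reindex[OF inj_on_moved])
qed

lemma card_shift_edges:
  assumes "finite E"
  shows "card (shift_edges i j E) = card E"
proof -
  have "card (shift_edges i j E) = card (E - moved_edges i j E) + card (moved_edges i j E)"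
    using shift_edges_sum[OF assms, of "\<lambda>_. 1" i j] by simp
  also have "\<dots> = card E"
    using assms by (subst card_Diff_subset) (auto simp: moved_edges_def card_mono)
  finally show ?thesis .
qed

lemma shift_edges_subset:
  assumes "E \<subseteq> nsets V 2" "i \<in> V"
  shows "shift_edges i j E \<subseteq> nsets V 2"
proof -
  have "insert i (e - {j}) \<in> nsets V 2" if "e \<in> moved_edges i j E" for e
  proof -
    have "e \<in> nsets V 2" "j \<in> e" "i \<notin> e" using that assms by (auto simp: moved_edges_def)
    then show ?thesis using assms by (auto simp: nsets_def card_Diff_singleton)
  qed
  then show ?thesis using assms by (auto simp: shift_edges_def)
qed

lemma moved_edges_pair:
  assumes "i \<noteq> j" "w \<notin> {i, j}"
  shows "{w, j} \<in> moved_edges i j E \<longleftrightarrow> {w, j} \<in> E \<and> {w, i} \<notin> E"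
proof -
  have "insert i ({w, j} - {j}) = {w, i}" using assms by auto
  then show ?thesis using assms by (auto simp: moved_edges_def)
qed

lemma shift_edges_pair:
  assumes "i \<noteq> j"
  shows "x \<notin> {i, j} \<Longrightarrow> y \<notin> {i, j} \<Longrightarrow> {x, y} \<in> shift_edges i j E \<longleftrightarrow> {x, y} \<in> E"
    and "{i, j} \<in> shift_edges i j E \<longleftrightarrow> {i, j} \<in> E"
    and "w \<notin> {i, j} \<Longrightarrow> {w, i} \<in> shift_edges i j E \<longleftrightarrow> {w, i} \<in> E \<or> {w, j} \<in> E"
    and "w \<notin> {i, j} \<Longrightarrow> {w, j} \<in> shift_edges i j E \<longleftrightarrow> {w, i} \<in> E \<and> {w, j} \<in> E"
proof -
  show "{x, y} \<in> shift_edges i j E \<longleftrightarrow> {x, y} \<in> E" if "x \<notin> {i, j}" "y \<notin> {i, j}"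
    using that by (auto simp: shift_edges_def moved_edges_def)
  show "{i, j} \<in> shift_edges i j E \<longleftrightarrow> {i, j} \<in> E"
    using assms by (auto simp: shift_edges_def moved_edges_def)
  assume w: "w \<notin> {i, j}"
  have "{w, i} = insert i (e - {j}) \<longleftrightarrow> e = {w, j}" if "e \<in> moved_edges i j E" for e
  proof -
    have "j \<in> e" "i \<notin> e" using that by (auto simp: moved_edges_def)
    then show ?thesis using w assms by auto
  qed
  then have "{w, i} \<in> (\<lambda>e. insert i (e - {j})) ` moved_edges i j E \<longleftrightarrow> {w, j} \<in> moved_edges i j E"
    by auto
  moreover have "{w, i} \<notin> moved_edges i j E" using w by (auto simp: moved_edges_def)
  ultimately show "{w, i} \<in> shift_edges i j E \<longleftrightarrow> {w, i} \<in> E \<or> {w, j} \<in> E"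
    unfolding shift_edges_def using moved_edges_pair[OF assms w, of E] by auto
  have "{w, j} \<notin> (\<lambda>e. insert i (e - {j})) ` moved_edges i j E" using w assms by auto
  then show "{w, j} \<in> shift_edges i j E \<longleftrightarrow> {w, i} \<in> E \<and> {w, j} \<in> E"
    unfolding shift_edges_def using moved_edges_pair[OF assms w, of E] by auto
qed

lemma num_cliques_shift_edges:
  assumes "finite V" "i \<in> V" "j \<in> V" "i \<noteq> j"
  shows "num_cliques r V E \<le> num_cliques r V (shift_edges i j E)"
  unfolding num_cliques_eq
  by (rule card_pairwise_sets_shift[of V i j])
    (use assms shift_edges_pair[OF assms(4), where E = E] in \<open>auto simp: insert_commute\<close>)

text \<open>Non-adjacency moves the opposite way: the non-neighbours of \<open>j\<close> become the
  union and those of \<open>i\<close> the intersection, so the shifting lemma applies with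
  \<open>i\<close> and \<open>j\<close> exchanged.\<close>

lemma num_indeps_shift_edges:
  assumes "finite V" "i \<in> V" "j \<in> V" "i \<noteq> j"
  shows "num_indeps r V E \<le> num_indeps r V (shift_edges i j E)"
  unfolding num_indeps_eq
  by (rule card_pairwise_sets_shift[of V j i])
    (use assms shift_edges_pair[OF assms(4), where E = E] in \<open>auto simp: insert_commute\<close>)

definition shifted :: "('a \<Rightarrow> nat) \<Rightarrow> 'a set \<Rightarrow> 'a set set \<Rightarrow> bool" where
  "shifted f V E \<longleftrightarrow>
     (\<forall>i\<in>V. \<forall>j\<in>V. \<forall>w\<in>V. f i < f j \<longrightarrow> w \<notin> {i, j} \<longrightarrow> {w, j} \<in> E \<longrightarrow> {w, i} \<in> E)"

text \<open>Every violating triple allows a shift that moves at least one edge, and each moved edge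
  loses rank; so the total rank of all edges strictly decreases.\<close>

lemma ex_shifted:
  fixes f :: "'a \<Rightarrow> nat"
  assumes fin: "finite V" and E: "E \<subseteq> nsets V 2"
  shows "\<exists>E'. E' \<subseteq> nsets V 2 \<and> card E' = card E \<and> num_cliques r V E \<le> num_cliques r V E'
     \<and> num_indeps r V E \<le> num_indeps r V E' \<and> shifted f V E'"
  using E
proof (induction "\<Sum>e\<in>E. sum f e" arbitrary: E rule: less_induct)
  case less
  show ?case
  proof (cases "shifted f V E")
    case True
    then show ?thesis using less.prems by blast
  next
    case False
    then obtain i j w where ij: "i \<in> V" "j \<in> V" "f i < f j" and w: "w \<in> V" "w \<notin> {i, j}" "{w, j} \<in> E" "{w, i} \<notin> E"
      unfolding shifted_def by blast
    have ne: "i \<noteq> j" using ij by auto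
    have finE: "finite E" using less.prems fin finite_imp_finite_nsets finite_subset by metis
    let ?M = "moved_edges i j E"
    have M: "finite ?M" "?M \<subseteq> E" using finE by (auto simp: moved_edges_def)
    have Mne: "?M \<noteq> {}" using moved_edges_pair[OF ne w(2)] w by blast
    have lt: "sum f (insert i (e - {j})) < sum f e" if "e \<in> ?M" for e
    proof -
      have e: "j \<in> e" "i \<notin> e" "finite e"
        using that less.prems by (auto simp: moved_edges_def nsets_def)
      then have "sum f (insert i (e - {j})) = f i + sum f (e - {j})" by simp
      also have "\<dots> < f j + sum f (e - {j})" using ij by simp
      also have "\<dots> = sum f e" using e by (simp add: sum.remove)
      finally show ?thesis .
    qed
    have "(\<Sum>e\<in>shift_edges i j E. sum f e)
        = (\<Sum>e\<in>E - ?M. sum f e) + (\<Sum>e\<in>?M. sum f (insert i (e - {j})))"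
      by (rule shift_edges_sum[OF finE])
    also have "\<dots> < (\<Sum>e\<in>E - ?M. sum f e) + (\<Sum>e\<in>?M. sum f e)"
      by (intro add_strict_left_mono sum_strict_mono M Mne lt)
    also have "\<dots> = (\<Sum>e\<in>E. sum f e)" using sum.subset_diff[OF M(2) finE] by metis
    finally have "\<exists>E'. E' \<subseteq> nsets V 2 \<and> card E' = card (shift_edges i j E)
       \<and> num_cliques r V (shift_edges i j E) \<le> num_cliques r V E'
       \<and> num_indeps r V (shift_edges i j E) \<le> num_indeps r V E' \<and> shifted f V E'"
      by (rule less.hyps) (rule shift_edges_subset[OF less.prems ij(1)])
    then show ?thesis
      using card_shift_edges[OF finE, of i j] num_cliques_shift_edges[OF fin ij(1,2) ne, of r E]
        num_indeps_shift_edges[OF fin ij(1,2) ne, of r E]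
      by (metis order_trans)
  qed
qed

text \<open>The candidates are the vertex \<open>a\<close> of least rank and \<open>b\<close> of
  greatest rank: an edge from \<open>b\<close> to anything shifts to the edge b a, and this in turn
  to the edge a u for every other u.\<close>

lemma shifted_dominating_or_isolated:
  assumes inj: "inj_on f V" and fin: "finite V" and ne: "V \<noteq> {}" and sh: "shifted f V E"
  shows "\<exists>v\<in>V. \<exists>d. \<forall>w\<in>V - {v}. {v, w} \<in> E \<longleftrightarrow> d"
proof -
  have "Min (f ` V) \<in> f ` V" "Max (f ` V) \<in> f ` V" using fin ne by auto
  then obtain a b where "a \<in> V" "f a = Min (f ` V)" "b \<in> V" "f b = Max (f ` V)" by (metis imageE)
  then have a: "a \<in> V" "\<And>w. w \<in> V \<Longrightarrow> f a \<le> f w" and b: "b \<in> V" "\<And>w. w \<in> V \<Longrightarrow> f w \<le> f b"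
    using fin by auto
  have alt: "f a < f w" if "w \<in> V" "w \<noteq> a" for w
    using that a inj by (metis inj_onD order_le_less)
  have blt: "f w < f b" if "w \<in> V" "w \<noteq> b" for w
    using that b inj by (metis inj_onD order_le_less)
  have sh': "{w, i} \<in> E" if "{w, j} \<in> E" "i \<in> V" "j \<in> V" "w \<in> V" "f i < f j" "w \<notin> {i, j}" for i j w
    using sh that unfolding shifted_def by blast
  show ?thesis
  proof (cases "\<forall>w\<in>V - {a}. {a, w} \<in> E")
    case True
    then show ?thesis using a by blast
  next
    case False
    then obtain u where u: "u \<in> V" "u \<noteq> a" "{a, u} \<notin> E" by auto
    have "{b, w} \<notin> E" if w: "w \<in> V" "w \<noteq> b" for w
    proof
      assume bw: "{b, w} \<in> E"
      have ab: "a \<noteq> b" using blt[OF w] a(2)[OF w(1)] by auto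
      have "{b, a} \<in> E"
        using bw sh'[OF bw a(1) w(1) b(1)] alt[OF w(1)] w ab by (cases "w = a") auto
      then have "{a, b} \<in> E" by (simp add: insert_commute)
      then have "{a, u} \<in> E"
        using sh'[of a b u] a b u ab blt[OF u(1)] by (cases "u = b") auto
      then show False using u by simp
    qed
    then show ?thesis using b by blast
  qed
qed

text \<open>Indices follow the order of removal, so adjacency of two vertices is decided by the one
  removed earlier.\<close>

lemma shifted_elimination_order:
  assumes "finite V" "inj_on f V" "shifted f V E" "card V = n"
  shows "\<exists>x D. bij_betw x {..<n} V \<and> (\<forall>i<n. \<forall>j<i. {x j, x i} \<in> E \<longleftrightarrow> D j)"
  using assms
proof (induction n arbitrary: V)
  case 0
  then show ?case by (auto simp: bij_betw_def)
next
  case (Suc n)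
  then have ne: "V \<noteq> {}" by auto
  obtain v d where v: "v \<in> V" and d: "\<And>w. w \<in> V - {v} \<Longrightarrow> {v, w} \<in> E \<longleftrightarrow> d"
    using shifted_dominating_or_isolated[OF Suc.prems(2,1) ne Suc.prems(3)] by blast
  have "inj_on f (V - {v})" "shifted f (V - {v}) E" "card (V - {v}) = n"
    using Suc.prems v by (auto simp: shifted_def inj_on_diff)
  then obtain x D where x: "bij_betw x {..<n} (V - {v})"
    and D: "\<forall>i<n. \<forall>j<i. {x j, x i} \<in> E \<longleftrightarrow> D j"
    using Suc.IH[of "V - {v}"] Suc.prems by auto
  let ?x = "case_nat v x" and ?D = "case_nat d D"
  have "?x ` {..<Suc n} = insert v (x ` {..<n})"
    by (simp add: lessThan_Suc_eq_insert_0 image_image)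
  also have "\<dots> = V" using x v by (auto simp: bij_betw_def)
  finally have im: "?x ` {..<Suc n} = V" .
  have "inj_on ?x {..<Suc n}"
    by (rule eq_card_imp_inj_on) (simp_all add: im Suc.prems)
  then have "bij_betw ?x {..<Suc n} V" using im by (simp add: bij_betw_def)
  moreover have "{?x j, ?x i} \<in> E \<longleftrightarrow> ?D j" if "i < Suc n" "j < i" for i j
  proof -
    have "0 < i" using that by simp
    then obtain i' where i': "i = Suc i'" by (auto simp: gr0_conv_Suc)
    have xi: "x i' \<in> V - {v}" using x that i' by (auto simp: bij_betw_def)
    show ?thesis using d[OF xi] D that i' by (cases j) auto
  qed
  ultimately show ?case by blast
qed

text \<open>Each set is charged to its vertex of largest index; the other \<open>p\<close> vertices
  are earlier ones related to it.\<close>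

lemma card_pairwise_sets_le_sum_choose:
  fixes x :: "nat \<Rightarrow> 'a"
  assumes x: "bij_betw x {..<n} V"
    and sym: "\<And>u v. P u v = P v u"
  shows "card (pairwise_sets (Suc p) V P) \<le> (\<Sum>i<n. card {j. j < i \<and> P (x j) (x i)} choose p)"
proof -
  let ?N = "\<lambda>i. {j. j < i \<and> P (x j) (x i)}"
  let ?T = "\<lambda>i. {T. T \<subseteq> ?N i \<and> card T = p}"
  have finN: "finite (?N i)" for i by simp
  have finT: "finite (?T i)" for i
    by (rule finite_subset[of _ "Pow (?N i)"]) auto
  have inj: "inj_on x {..<n}" and im: "x ` {..<n} = V" using x by (auto simp: bij_betw_def)
  have "pairwise_sets (Suc p) V P \<subseteq> (\<Union>i<n. (\<lambda>T. x ` insert i T) ` ?T i)"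
  proof
    fix R assume "R \<in> pairwise_sets (Suc p) V P"
    then have R: "R \<subseteq> V" "finite R" "card R = Suc p" "pairwise P R"
      by (auto simp: pairwise_sets_def nsets_def)
    obtain J where J: "J \<subseteq> {..<n}" "R = x ` J" using R(1) im by (metis subset_imageE)
    have injJ: "inj_on x J" using inj J(1) by (rule inj_on_subset)
    have cJ: "card J = Suc p" using R J card_image[OF injJ] by simp
    then have fJ: "finite J" "J \<noteq> {}" by (auto simp: card_ge_0_finite)
    define i where "i = Max J"
    have i: "i \<in> J" unfolding i_def using fJ by (rule Max_in)
    have "J - {i} \<in> ?T i"
    proof -
      have "P (x j) (x i)" if "j \<in> J" "j \<noteq> i" for j
        using R(4) J(2) that i injJ by (auto simp: pairwise_def inj_on_def)
      moreover have "j < i" if "j \<in> J" "j \<noteq> i" for j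
        using that Max_ge[OF fJ(1), of j] unfolding i_def by simp
      ultimately show ?thesis using cJ i by auto
    qed
    moreover have "R = x ` insert i (J - {i})" using J i by (simp add: insert_absorb)
    ultimately show "R \<in> (\<Union>i<n. (\<lambda>T. x ` insert i T) ` ?T i)" using i J by blast
  qed
  then have "card (pairwise_sets (Suc p) V P) \<le> card (\<Union>i<n. (\<lambda>T. x ` insert i T) ` ?T i)"
    using finT by (intro card_mono) auto
  also have "\<dots> \<le> (\<Sum>i<n. card ((\<lambda>T. x ` insert i T) ` ?T i))" by (rule card_UN_le) simp
  also have "\<dots> \<le> (\<Sum>i<n. card (?T i))" by (intro sum_mono card_image_le finT)
  also have "\<dots> = (\<Sum>i<n. card (?N i) choose p)" by (intro sum.cong refl n_subsets finN)
  finally show ?thesis .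
qed

section \<open>The asymptotic bound\<close>

text \<open>Lengths scale by \<open>c\<close> and areas by its square, so the sum is homogeneous of
  degree r.\<close>

lemma turn_sum_scale:
  assumes "c > 0"
  shows "turn_sum q (c * a) (c\<^sup>2 * X) (c\<^sup>2 * Y) = c ^ Suc (Suc q) * turn_sum q a X Y"
proof -
  have "(c\<^sup>2 * Y) ^ Suc q / (c * a) ^ q = c ^ Suc (Suc q) * (Y ^ Suc q / a ^ q)"
  proof -
    have "(c\<^sup>2) ^ Suc q = c ^ q * c ^ Suc (Suc q)"
      unfolding power_mult[symmetric] power_add[symmetric] by (rule arg_cong[where f = "power c"]) simp
    then show ?thesis
      unfolding power_mult_distrib using assms by (simp del: power_Suc)
  qed
  moreover have "(c * a) ^ q * (c\<^sup>2 * X) = c ^ Suc (Suc q) * (a ^ q * X)"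
    by (simp add: power_mult_distrib power2_eq_square)
  ultimately show ?thesis unfolding turn_sum_def by (simp only: distrib_left)
qed

lemma num_cliques_2:
  assumes "E \<subseteq> nsets V 2"
  shows "num_cliques 2 V E = card E"
proof -
  have "{R \<in> nsets V 2. clique R E} = E"
    using assms by (fastforce simp: clique_def insert_commute elim!: nsets2_E)
  then show ?thesis by (simp add: num_cliques_def)
qed

lemma num_cliques_add_num_indeps_2:
  assumes fin: "finite V" and E: "E \<subseteq> nsets V 2"
  shows "num_cliques 2 V E + num_indeps 2 V E = card V choose 2"
proof -
  have "{R \<in> nsets V 2. indep R E} = nsets V 2 - E"
    by (fastforce simp: indep_def insert_commute elim!: nsets2_E)
  then have "num_indeps 2 V E = card (nsets V 2) - card E"
    unfolding num_indeps_def using E fin by (simp add: card_Diff_subset finite_imp_finite_nsets finite_subset)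
  moreover have "card E \<le> card (nsets V 2)" using E fin by (intro card_mono finite_imp_finite_nsets)
  moreover have "card (nsets V 2) = card V choose 2" using fin by simp
  ultimately show ?thesis using num_cliques_2[OF E] by simp
qed

text \<open>A bound for every single n: the passage from the discrete to the continuous path affects
  only the density, which becomes \<rho>'.\<close>

lemma clique_indep_bound:
  assumes q: "q \<ge> 1" and G: "finite_simple_graph V E" and n: "card V = n" "n \<ge> 1"
  defines "r \<equiv> Suc (Suc q)"
  shows "\<exists>\<rho>'. \<bar>\<rho>' - 2 * real (card E) / (real n)\<^sup>2\<bar> \<le> 1 / real n \<and>
     real (num_cliques r V E + num_indeps r V E) * fact r
     \<le> real n ^ r * clique_density r (max (sqrt \<rho>') (sqrt (1 - \<rho>')))"
proof -
  have fin: "finite V" and E: "E \<subseteq> nsets V 2" using G by (auto simp: finite_simple_graph_def)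
  obtain f :: "'a \<Rightarrow> nat" where f: "inj_on f V" using finite_imp_inj_to_nat_seg[OF fin] by blast
  obtain F where F: "F \<subseteq> nsets V 2" "card F = card E" "num_cliques r V E \<le> num_cliques r V F"
      "num_indeps r V E \<le> num_indeps r V F" "shifted f V F"
    using ex_shifted[OF fin E] by blast
  obtain x D where x: "bij_betw x {..<n} V" and D: "\<forall>i<n. \<forall>j<i. {x j, x i} \<in> F \<longleftrightarrow> D j"
    using shifted_elimination_order[OF fin f F(5) n(1)] by blast
  define a where "a = (\<lambda>i. card {j. j < i \<and> D j})"
  define b where "b = (\<lambda>i. card {j. j < i \<and> \<not> D j})"
  have aS: "a (Suc i) = (if D i then Suc (a i) else a i)"
    and bS: "b (Suc i) = (if D i then b i else Suc (b i))" for i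
  proof -
    have "{j. j < Suc i \<and> D j} = (if D i then insert i {j. j < i \<and> D j} else {j. j < i \<and> D j})"
      "{j. j < Suc i \<and> \<not> D j} = (if D i then {j. j < i \<and> \<not> D j} else insert i {j. j < i \<and> \<not> D j})"
      by (auto simp: less_Suc_eq)
    then show "a (Suc i) = (if D i then Suc (a i) else a i)"
      "b (Suc i) = (if D i then b i else Suc (b i))"
      by (auto simp: a_def b_def)
  qed
  have ab0: "a 0 = 0" "b 0 = 0" by (simp_all add: a_def b_def)
  have ab: "a i + b i = i" for i by (induction i) (auto simp: aS bS ab0)
  have K: "num_cliques (Suc p) V F \<le> (\<Sum>i<n. a i choose p)" for p
  proof -
    have "num_cliques (Suc p) V F \<le> (\<Sum>i<n. card {j. j < i \<and> {x j, x i} \<in> F} choose p)"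
      unfolding num_cliques_eq
      by (rule card_pairwise_sets_le_sum_choose[OF x]) (simp add: insert_commute)
    also have "\<dots> = (\<Sum>i<n. a i choose p)"
    proof (intro sum.cong refl)
      fix i assume "i \<in> {..<n}"
      then have "{j. j < i \<and> {x j, x i} \<in> F} = {j. j < i \<and> D j}" using D by auto
      then show "card {j. j < i \<and> {x j, x i} \<in> F} choose p = a i choose p" by (simp add: a_def)
    qed
    finally show ?thesis .
  qed
  have I: "num_indeps (Suc p) V F \<le> (\<Sum>i<n. b i choose p)" for p
  proof -
    have "num_indeps (Suc p) V F \<le> (\<Sum>i<n. card {j. j < i \<and> {x j, x i} \<notin> F} choose p)"
      unfolding num_indeps_eq
      by (rule card_pairwise_sets_le_sum_choose[OF x]) (simp add: insert_commute)
    also have "\<dots> = (\<Sum>i<n. b i choose p)"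
    proof (intro sum.cong refl)
      fix i assume "i \<in> {..<n}"
      then have "{j. j < i \<and> {x j, x i} \<notin> F} = {j. j < i \<and> \<not> D j}" using D by auto
      then show "card {j. j < i \<and> {x j, x i} \<notin> F} choose p = b i choose p" by (simp add: b_def)
    qed
    finally show ?thesis .
  qed
  \<comment> \<open>The counting lemma gives upper bounds only, but for pairs both bounds together
    add up to n choose 2, which forces equality.\<close>
  have edges: "card E = (\<Sum>i<n. a i)"
  proof -
    have "num_cliques 2 V F \<le> (\<Sum>i<n. a i)" "num_indeps 2 V F \<le> (\<Sum>i<n. b i)"
      using K[of 1] I[of 1] by (simp_all add: numeral_2_eq_2)
    moreover have "(\<Sum>i<n. a i) + (\<Sum>i<n. b i) = n choose 2"
    proof -
      have "(\<Sum>i<n. a i) + (\<Sum>i<n. b i) = (\<Sum>i<n. i)"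
        unfolding sum.distrib[symmetric] by (simp add: ab)
      also have "\<dots> = n choose 2" by (induction n) (simp_all add: numeral_2_eq_2)
      finally show ?thesis .
    qed
    ultimately show ?thesis
      using num_cliques_add_num_indeps_2[OF fin F(1)] num_cliques_2[OF F(1)] F(2) unfolding n(1) by linarith
  qed
  define A B where "A = real (a n) / real n" and "B = real (b n) / real n"
  define X where "X = ((\<Sum>i<n. real (a i)) - real (a n) * (real (a n) - 1) / 2) / (real n)\<^sup>2"
  define Y where "Y = ((\<Sum>i<n. real (b i)) - real (b n) * (real (b n) - 1) / 2) / (real n)\<^sup>2"
  have n0: "real n > 0" using n by simp
  have sc: "real (a n) = real n * A" "real (b n) = real n * B"
      "(\<Sum>i<n. real (a i)) - real (a n) * (real (a n) - 1) / 2 = (real n)\<^sup>2 * X"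
      "(\<Sum>i<n. real (b i)) - real (b n) * (real (b n) - 1) / 2 = (real n)\<^sup>2 * Y"
    using n0 by (simp_all add: A_def B_def X_def Y_def)
  have step: "real (a (Suc i)) = real (a i) + 1 \<and> real (b (Suc i)) = real (b i) \<or>
     real (a (Suc i)) = real (a i) \<and> real (b (Suc i)) = real (b i) + 1" for i
    by (auto simp: aS bS)
  have ab0': "real (a 0) = 0" "real (b 0) = 0" by (simp_all add: ab0)
  note path = lattice_path_power_sum[where a = "\<lambda>i. real (a i)" and b = "\<lambda>i. real (b i)" and n = n,
      OF q ab0' step, unfolded sc(3,4), unfolded sc(1,2)]
  have nn: "0 \<le> A" "0 \<le> B" by (auto simp: A_def B_def)
  have XY0: "0 \<le> X" "0 \<le> Y" and XY: "(real n)\<^sup>2 * X + (real n)\<^sup>2 * Y = real n * A * (real n * B)"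
    using path n0 by (auto simp: zero_le_mult_iff)
  have "(real n)\<^sup>2 * (X + Y) = (real n)\<^sup>2 * (A * B)"
    using XY by (simp add: power2_eq_square algebra_simps)
  then have XY': "X + Y = A * B" using n0 by simp
  have AB: "A + B = 1"
    using ab[of n] n0 by (simp add: A_def B_def add_divide_distrib[symmetric] flip: of_nat_add)
  \<comment> \<open>The triangular number a (a - 1) / 2 is replaced by a^2 / 2; this accounts for
    the excess a / n^2 over the edge term, which is at most 1/n.\<close>
  define \<rho>' where "\<rho>' = A\<^sup>2 + 2 * X"
  have "(real n)\<^sup>2 * \<rho>' = 2 * real (card E) + real (a n)"
    unfolding \<rho>'_def distrib_left edges using sc(1,3) by (simp add: power2_eq_square field_simps)
  then have "\<rho>' - 2 * real (card E) / (real n)\<^sup>2 = real (a n) / (real n)\<^sup>2"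
    using n0 by (simp add: field_simps)
  also have "\<bar>\<dots>\<bar> \<le> real n / (real n)\<^sup>2"
    using ab[of n] by (simp add: divide_right_mono)
  also have "\<dots> = 1 / real n" using n0 by (simp add: power2_eq_square)
  finally have 1: "\<bar>\<rho>' - 2 * real (card E) / (real n)\<^sup>2\<bar> \<le> 1 / real n" .
  have choose: "real (k choose p) * fact p \<le> real k ^ p" for k p :: nat
  proof -
    have "real ((k choose p) * fact p) \<le> real (k ^ p)"
      using binomial_fact_pow[of k p] by (simp only: of_nat_le_iff)
    then show ?thesis by simp
  qed
  have "real (num_cliques r V E + num_indeps r V E) \<le> (\<Sum>i<n. real (a i choose Suc q) + real (b i choose Suc q))"
  proof -
    have "num_cliques r V E + num_indeps r V E \<le> (\<Sum>i<n. (a i choose Suc q) + (b i choose Suc q))"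
      using F(3,4) K[of "Suc q"] I[of "Suc q"] unfolding r_def sum.distrib by linarith
    then have "real (num_cliques r V E + num_indeps r V E) \<le> real (\<Sum>i<n. (a i choose Suc q) + (b i choose Suc q))"
      by (simp only: of_nat_le_iff)
    then show ?thesis by simp
  qed
  then have "real (num_cliques r V E + num_indeps r V E) * fact r
      \<le> (\<Sum>i<n. real (a i choose Suc q) + real (b i choose Suc q)) * fact r"
    by (intro mult_right_mono) auto
  also have "\<dots> = real r * (\<Sum>i<n. real (a i choose Suc q) * fact (Suc q) + real (b i choose Suc q) * fact (Suc q))"
    unfolding r_def fact_Suc[of "Suc q"] distrib_right[of _ _ "fact (Suc q)", symmetric]
      sum_distrib_right[symmetric] by simp
  also have "\<dots> \<le> real r * (\<Sum>i<n. real (a i) ^ Suc q + real (b i) ^ Suc q)"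
    by (intro mult_left_mono sum_mono add_mono choose) simp
  also have "\<dots> \<le> (real n * A) ^ r + (real n * B) ^ r + real r *
      max (turn_sum q (real n * A) ((real n)\<^sup>2 * X) ((real n)\<^sup>2 * Y)) (turn_sum q (real n * B) ((real n)\<^sup>2 * Y) ((real n)\<^sup>2 * X))"
    using path unfolding r_def by simp
  also have "\<dots> = real n ^ r * (A ^ r + B ^ r + real r * max (turn_sum q A X Y) (turn_sum q B Y X))"
  proof -
    have "max (real n ^ r * turn_sum q A X Y) (real n ^ r * turn_sum q B Y X)
        = real n ^ r * max (turn_sum q A X Y) (turn_sum q B Y X)"
      using n0 by (simp add: max_mult_distrib_left)
    then show ?thesis
      unfolding turn_sum_scale[OF n0] r_def[symmetric] by (simp add: power_mult_distrib algebra_simps)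
  qed
  also have "\<dots> \<le> real n ^ r * clique_density r (max (sqrt \<rho>') (sqrt (1 - \<rho>')))"
    unfolding r_def \<rho>'_def
    using turn_sums_le_clique_density[OF q nn XY0 AB XY'] by (intro mult_left_mono) auto
  finally show ?thesis using 1 by blast
qed

lemma power_over_binomial_tendsto:
  "(\<lambda>n. real n ^ r / (fact r * real (n choose r))) \<longlonglongrightarrow> 1"
proof -
  have "(\<lambda>n. \<Prod>i<r. 1 - real i / real n) \<longlonglongrightarrow> (\<Prod>i<r. 1 - 0)"
    by (intro tendsto_intros lim_const_over_n)
  then have "(\<lambda>n. 1 / (\<Prod>i<r. 1 - real i / real n)) \<longlonglongrightarrow> 1"
    by (auto intro!: tendsto_eq_intros)
  moreover have "\<forall>\<^sub>F n in sequentially. 1 / (\<Prod>i<r. 1 - real i / real n) = real n ^ r / (fact r * real (n choose r))"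
    using eventually_ge_at_top[of "Suc r"]
  proof eventually_elim
    case (elim n)
    have "fact r * real (n choose r) = (\<Prod>i<r. real n - real i)"
      by (simp add: binomial_gbinomial gbinomial_prod_rev atLeast0LessThan)
    also have "\<dots> = (\<Prod>i<r. real n * (1 - real i / real n))"
      using elim by (intro prod.cong) (auto simp: field_simps)
    also have "\<dots> = real n ^ r * (\<Prod>i<r. 1 - real i / real n)"
      by (simp add: prod.distrib)
    finally show ?case using elim by simp
  qed
  ultimately show ?thesis by (rule Lim_transform_eventually)
qed

theorem theorem1p1:
  fixes r :: nat and \<rho> \<gamma> :: real
    and V :: "nat \<Rightarrow> 'a set" and E :: "nat \<Rightarrow> 'a set set"
  assumes "r \<ge> 3"
    and "0 \<le> \<rho>" and "\<rho> \<le> 1"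
    and "\<And>n. finite_simple_graph (V n) (E n)"
    and "\<And>n. card (V n) = n"
    and "(\<lambda>n. edge_density (V n) (E n)) \<longlonglongrightarrow> \<rho>"
    and "\<gamma> = (if \<rho> \<le> 1/2 then sqrt (1 - \<rho>) else sqrt \<rho>)"
  shows "limsup (\<lambda>n. ereal (real (num_cliques r (V n) (E n) + num_indeps r (V n) (E n))
                              / real (n choose r)))
         \<le> ereal (\<gamma> ^ r + (1 - \<gamma>) ^ r + real r * \<gamma> * (1 - \<gamma>) ^ (r - 1))"
proof -
  obtain q where r: "r = Suc (Suc q)" and q: "q \<ge> 1"
    using assms(1) by (intro that[of "r - 2"]) auto
  let ?S = "\<lambda>n. real (num_cliques r (V n) (E n) + num_indeps r (V n) (E n))"
  let ?h = "\<lambda>\<rho>. clique_density r (max (sqrt \<rho>) (sqrt (1 - \<rho>)))"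
  have "\<exists>\<rho>'. \<bar>\<rho>' - 2 * real (card (E n)) / (real n)\<^sup>2\<bar> \<le> 1 / real n \<and> ?S n * fact r \<le> real n ^ r * ?h \<rho>'"
    if "n \<ge> 1" for n
    unfolding r using clique_indep_bound[OF q assms(4,5) that] .
  then obtain \<sigma> where \<sigma>: "\<And>n. n \<ge> 1 \<Longrightarrow> \<bar>\<sigma> n - 2 * real (card (E n)) / (real n)\<^sup>2\<bar> \<le> 1 / real n"
      "\<And>n. n \<ge> 1 \<Longrightarrow> ?S n * fact r \<le> real n ^ r * ?h (\<sigma> n)"
    by metis
  \<comment> \<open>The factor 1 - 1/n converts the normalisation by n choose 2 into one by n^2 /
    2.\<close>
  have "(\<lambda>n. edge_density (V n) (E n) * (1 - 1 / real n)) \<longlonglongrightarrow> \<rho> * (1 - 0)"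
    by (intro tendsto_intros assms(6) lim_const_over_n)
  moreover have "\<forall>\<^sub>F n in sequentially. edge_density (V n) (E n) * (1 - 1 / real n) = 2 * real (card (E n)) / (real n)\<^sup>2"
    using eventually_ge_at_top[of 2]
  proof eventually_elim
    case (elim n)
    have choose: "real (n choose 2) = real n * (real n - 1) / 2"
      using elim by (simp add: choose_two real_of_nat_div of_nat_diff)
    show ?case
      unfolding edge_density_def assms(5) choose using elim by (simp add: power2_eq_square divide_simps)
  qed
  ultimately have dens: "(\<lambda>n. 2 * real (card (E n)) / (real n)\<^sup>2) \<longlonglongrightarrow> \<rho>"
    using Lim_transform_eventually by fastforce
  have "(\<lambda>n. \<sigma> n - 2 * real (card (E n)) / (real n)\<^sup>2) \<longlonglongrightarrow> 0"
    by (rule tendsto_0_le[OF lim_const_over_n[of "1 :: real"], where K = 1])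
      (use \<sigma>(1) in \<open>auto intro!: eventually_sequentiallyI[of 1]\<close>)
  from tendsto_add[OF this dens] have \<sigma>lim: "\<sigma> \<longlonglongrightarrow> \<rho>" by simp
  \<comment> \<open>\<open>sqrt\<close> is continuous on the whole real line, so the limit passes
    through also when \<rho> is 0 or 1.\<close>
  have "(\<lambda>n. ?h (\<sigma> n)) \<longlonglongrightarrow> ?h \<rho>"
    unfolding clique_density_def by (intro tendsto_intros \<sigma>lim)
  then have "(\<lambda>n. real n ^ r / (fact r * real (n choose r)) * ?h (\<sigma> n)) \<longlonglongrightarrow> 1 * ?h \<rho>"
    by (intro tendsto_mult power_over_binomial_tendsto)
  then have lim: "limsup (\<lambda>n. ereal (real n ^ r / (fact r * real (n choose r)) * ?h (\<sigma> n))) = ereal (?h \<rho>)"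
    by (intro lim_imp_Limsup) auto
  have "limsup (\<lambda>n. ereal (?S n / real (n choose r)))
      \<le> limsup (\<lambda>n. ereal (real n ^ r / (fact r * real (n choose r)) * ?h (\<sigma> n)))"
  proof (rule Limsup_mono, rule eventually_sequentiallyI[of r])
    fix n assume n: "r \<le> n"
    then have "n \<ge> 1" "real (n choose r) > 0" using r by (auto simp: zero_less_binomial)
    then show "ereal (?S n / real (n choose r)) \<le> ereal (real n ^ r / (fact r * real (n choose r)) * ?h (\<sigma> n))"
    proof -
      have "?S n \<le> real n ^ r * ?h (\<sigma> n) / fact r"
        using \<sigma>(2)[OF \<open>n \<ge> 1\<close>] by (simp add: pos_le_divide_eq)
      then have "?S n / real (n choose r) \<le> real n ^ r * ?h (\<sigma> n) / fact r / real (n choose r)"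
        by (rule divide_right_mono) simp
      then show ?thesis by simp
    qed
  qed
  also have "\<dots> = ereal (?h \<rho>)" by (rule lim)
  also have "max (sqrt \<rho>) (sqrt (1 - \<rho>)) = \<gamma>"
    using assms(2,3,7) by (auto simp: max_def)
  finally show ?thesis by (simp add: clique_density_def)
qed

end
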